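(* Let $Z(s)=\gamma(s)D(s)$ be an element of $\mathcal F$, $\epsilon=\pm1$, and let $\phi$ be a real-valued smooth compactly supported function on $\mathbb R_+^\times$. If $Z(s)$ satisfies the functional equation $Z(s)=\epsilon Z(1-s)$ and $D(s)=\sum_{m\ge1}d_mm^{-s}$ for $\mathrm{Re}(s)>\sigma_0$, then $$\sum_{\lambda}\sum_{m=1}^{m_\lambda}\frac{C_m(\lambda)}{(m-1)!}\,\mathsf M(\phi)^{(m-1)}(\lambda)=\sum_{m\ge1}d_m\left[(\phi\ast_\times\kappa)(m)-\epsilon(\phi^\vee\ast_\times\kappa)(m)\right],$$ where $\lambda$ runs over the poles of $Z$, $m_\lambda$ is the multiplicity of $\lambda$, $\phi^\vee(x)=x^{-1}\phi(x^{-1})$, and $\kappa(x)$ is the inverse Mellin transform of $\gamma(s)$, namely $\kappa(x)=\frac1{2\pi i}\int_{(c)}\gamma(s)x^{-s}\,ds$ for $c>\sigma_0$.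
   Context: $\mathbb R_+^\times=(0,\infty)$. $\int_{(c)}$ is integration over the line $\mathrm{Re}(s)=c$. $\mathsf M(\phi)(s)=\int_0^\infty\phi(x)x^s\frac{dx}x$, and $\mathsf M(\phi)^{(k)}$ is its $k$-th derivative. $(f\ast_\times g)(x)=\int_0^\infty f(y)g(x/y)\frac{dy}y$. $\mathcal F$ is the set of complex-valued functions of the shape $Z(s)=\gamma(s)D(s)$ with $\gamma,D$ meromorphic on $\mathbb C$ such that: (i) all the poles of $Z$ belong to the vertical strip $|\mathrm{Re}(s)-1/2|\le w$ for some $w>0$; (ii) $|\gamma(\sigma+it)|\ll_{a,b,t_0}|t|^{-A}$ for all $\sigma\in[a,b]$ and $|t|\ge t_0$, for all real numbers $a\le b$ and every real $A>0$; (iii) if $\sigma>1/2+w$ then $D(\sigma+it)\ll|t|^{A_1}$ for some real number $A_1$; (iv) there exist a real number $A_2$ and a strictly increasing sequence of positive real numbers $(t_k)_{k\ge1}$ satisfying $|D(\sigma\pm it_k)|=O(t_k^{A_2})$ uniformly for $\sigma\in[1/2-w-\delta,1/2+w+\delta]$ for some $\delta>0$ and for all $k\ge1$. For a pole $\lambda$ of $Z$ of multiplicity $m_\lambda\ge1$, the numbers $C_m(\lambda)$ are the coefficients of the principal part: $Z(s)=\sum_{m=1}^{m_\lambda}C_m(\lambda)(s-\lambda)^{-m}+O(1)$ as $s\to\lambda$.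
   Formalization: In condition (iv) the heights t_k are taken to tend to infinity, and the sum over the poles λ, which need not converge unconditionally, is the limit as k→∞ of the finite sums over poles with |Im λ| < t_k. *)

theory Defs
  imports "HOL-Complex_Analysis.Complex_Analysis" "HOL-Library.Landau_Symbols"
begin

definition smooth_compact_support_pos :: "(real \<Rightarrow> real) \<Rightarrow> bool" where
  "smooth_compact_support_pos \<phi> \<longleftrightarrow>
     (\<forall>n. \<forall>x>0. (deriv ^^ n) \<phi> differentiable (at x)) \<and>
     (\<exists>K. compact K \<and> K \<subseteq> {0<..} \<and> (\<forall>x\<in>{0<..} - K. \<phi> x = 0))"

definition mellin :: "(real \<Rightarrow> complex) \<Rightarrow> complex \<Rightarrow> complex" where
  "mellin f s = (LINT x:{0<..}|lborel. f x * of_real x powr s / of_real x)"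

definition mult_conv :: "(real \<Rightarrow> complex) \<Rightarrow> (real \<Rightarrow> complex) \<Rightarrow> real \<Rightarrow> complex" where
  "mult_conv f g x = (LINT y:{0<..}|lborel. f y * g (x / y) / of_real y)"

definition vee :: "(real \<Rightarrow> complex) \<Rightarrow> real \<Rightarrow> complex" where
  "vee f x = f (1 / x) / of_real x"

(* Integral over the upward line Re s = c; the factor \<i> comes from ds = \<i> dt. *)
definition vertical_integral :: "real \<Rightarrow> (complex \<Rightarrow> complex) \<Rightarrow> complex" where
  "vertical_integral c f = \<i> * (LINT t|lborel. f (Complex c t))"

definition inverse_mellin :: "(complex \<Rightarrow> complex) \<Rightarrow> real \<Rightarrow> real \<Rightarrow> complex" where
  "inverse_mellin g c x =
     1 / (2 * of_real pi * \<i>) * vertical_integral c (\<lambda>s. g s * of_real x powr (- s))"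

definition pole_mult :: "(complex \<Rightarrow> complex) \<Rightarrow> complex \<Rightarrow> nat" where
  "pole_mult Z z = nat (- zorder Z z)"

(* C z m is the coefficient of (s - z)^(-m) in the principal part of Z at its pole z.
   These coefficients are unique for 1 \<le> m \<le> pole_mult Z z; other values of C do not matter. *)
definition principal_part_coeffs :: "(complex \<Rightarrow> complex) \<Rightarrow> (complex \<Rightarrow> nat \<Rightarrow> complex) \<Rightarrow> bool" where
  "principal_part_coeffs Z C \<longleftrightarrow>
     (\<forall>z. is_pole Z z \<longrightarrow>
        (\<lambda>s. Z s - (\<Sum>m=1..pole_mult Z z. C z m / (s - z) ^ m)) \<in> O[at z](\<lambda>_. 1))"

(* The conditions defining the class F, with the strip half-width w and the heights t of
   the horizontal segments made explicit.  The sequence t is indexed from 0.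
   The heights must tend to infinity: without that, the last condition would say nothing
   about D far up in the strip.  The bound for D to the right of the strip is only required to be
   uniform in Re s on compact intervals, which is implied by a bound uniform in Re s > 1/2 + w. *)
definition class_F_with ::
    "(complex \<Rightarrow> complex) \<Rightarrow> (complex \<Rightarrow> complex) \<Rightarrow> real \<Rightarrow> (nat \<Rightarrow> real) \<Rightarrow> bool" where
  "class_F_with \<gamma> D w t \<longleftrightarrow>
     \<gamma> meromorphic_on UNIV \<and> D meromorphic_on UNIV \<and>
     w > 0 \<and>
     (\<forall>z. is_pole (\<lambda>s. \<gamma> s * D s) z \<longrightarrow> \<bar>Re z - 1/2\<bar> \<le> w) \<and>
     (\<forall>a b A t0. a \<le> b \<longrightarrow> A > 0 \<longrightarrow> t0 > 0 \<longrightarrow>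
        (\<exists>B. \<forall>\<sigma>\<in>{a..b}. \<forall>y. \<bar>y\<bar> \<ge> t0 \<longrightarrow> norm (\<gamma> (Complex \<sigma> y)) \<le> B * \<bar>y\<bar> powr (- A))) \<and>
     (\<exists>A1. \<forall>a b. 1/2 + w < a \<longrightarrow> a \<le> b \<longrightarrow>
        (\<exists>B. \<exists>t0>0. \<forall>\<sigma>\<in>{a..b}. \<forall>y. \<bar>y\<bar> \<ge> t0 \<longrightarrow> norm (D (Complex \<sigma> y)) \<le> B * \<bar>y\<bar> powr A1)) \<and>
     strict_mono t \<and> (\<forall>k. t k > 0) \<and> filterlim t at_top sequentially \<and>
     (\<exists>A2 B. \<exists>\<delta>>0. \<forall>k. \<forall>\<sigma>\<in>{1/2 - w - \<delta> .. 1/2 + w + \<delta>}.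
        norm (D (Complex \<sigma> (t k))) \<le> B * t k powr A2 \<and>
        norm (D (Complex \<sigma> (- t k))) \<le> B * t k powr A2)"

definition class_F :: "(complex \<Rightarrow> complex) \<Rightarrow> (complex \<Rightarrow> complex) \<Rightarrow> bool" where
  "class_F \<gamma> D \<longleftrightarrow> (\<exists>w t. class_F_with \<gamma> D w t)"

(* Nothing in class F makes the sum over all poles converge unconditionally.
   It is summed by grouping the poles between consecutive heights: the partial
   sums run over the poles with |Im z| < t k, of which there are finitely many. *)
definition pole_sum_converges_to ::
    "(complex \<Rightarrow> complex) \<Rightarrow> (nat \<Rightarrow> real) \<Rightarrow> (complex \<Rightarrow> complex) \<Rightarrow> complex \<Rightarrow> bool" where
  "pole_sum_converges_to Z t a S \<longleftrightarrow>
     (\<forall>k. finite {z. is_pole Z z \<and> \<bar>Im z\<bar> < t k}) \<and>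
     (\<lambda>k. \<Sum>z | is_pole Z z \<and> \<bar>Im z\<bar> < t k. a z) \<longlonglongrightarrow> S"

end

theory Submission
  imports Defs "HOL-Probability.Sinc_Integral"
begin

text \<open>
  Mellin inversion turns the right-hand side into an integral over a line far to the right:
  absolute convergence of the Dirichlet series and the rapid decay of \<open>\<gamma>\<close> give
  \[\sum_m d_m (\phi * \kappa)(m) = \frac{1}{2\pi i}\int_{(c)} Z(s)\, M\phi(s)\, ds,\]
  and \<open>\<phi>\<^sup>\<or>\<close> has Mellin transform \<open>M\<phi>(1 - s)\<close>, so that by the functional equation its term is
  minus the integral of \<open>Z(s) M\<phi>(s)\<close> over the line \<open>Re s = 1 - c\<close>. The difference of the two
  vertical integrals is the limit of the integrals over the rectangles of heights \<open>t k\<close>, that is, of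
  the sums of the residues of \<open>Z(s) M\<phi>(s)\<close> in them. On the horizontal sides \<open>M\<phi>\<close> is bounded and
  the decay of \<open>\<gamma>\<close> beats the growth of \<open>D\<close>; the functional equation covers the left half.
\<close>

subsection \<open>Mellin transforms of compactly supported functions\<close>

text \<open>The support is enclosed in one interval [a, b] with a > 0, so every Mellin integral
  becomes an integral over a compact set away from 0. Values at nonpositive arguments are left free,
  as all integrals run over the positive half line.\<close>

definition supported_on :: "real \<Rightarrow> real \<Rightarrow> (real \<Rightarrow> complex) \<Rightarrow> bool" where
  "supported_on a b f \<longleftrightarrow>
     0 < a \<and> a \<le> b \<and> continuous_on {0<..} f \<and> (\<forall>x>0. x \<notin> {a..b} \<longrightarrow> f x = 0)"

lemma supported_onD:
  assumes "supported_on a b f"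
  shows "0 < a" "a \<le> b" "continuous_on {a..b} f" "\<And>x. x > 0 \<Longrightarrow> x \<notin> {a..b} \<Longrightarrow> f x = 0"
  using assms unfolding supported_on_def by (auto intro: continuous_on_subset)

lemma set_integral_supported_on:
  fixes h :: "real \<Rightarrow> complex"
  assumes "supported_on a b f"
  shows "(LINT x:{0<..}|lborel. f x * h x) = (LINT x:{a..b}|lborel. f x * h x)"
proof -
  note f = supported_onD[OF assms]
  have "indicator {0<..} x *\<^sub>R (f x * h x) = indicator {a..b} x *\<^sub>R (f x * h x)" for x
    using f by (cases "x > 0") (auto simp: indicator_def)
  then show ?thesis unfolding set_lebesgue_integral_def by (rule Bochner_Integration.integral_cong[OF refl])
qed

lemma continuous_on_powr_of_real:
  assumes "0 < a"
  shows "continuous_on {a..b} (\<lambda>x. of_real x powr s :: complex)"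
  using assms by (auto intro!: continuous_intros simp: complex_nonpos_Reals_iff)

lemma mellin_integrand_integrable:
  assumes "supported_on a b f"
  shows "set_integrable lborel {a..b} (\<lambda>x. f x * of_real x powr s / of_real x)"
  using supported_onD[OF assms]
  by (intro borel_integrable_atLeastAtMost' continuous_intros continuous_on_powr_of_real) auto

lemma mellin_eq_integral:
  assumes "supported_on a b f"
  shows "mellin f s = integral {a..b} (\<lambda>x. f x * of_real x powr s / of_real x)"
proof -
  have "mellin f s = (LINT x:{a..b}|lborel. f x * of_real x powr s / of_real x)"
    using set_integral_supported_on[OF assms, of "\<lambda>x. of_real x powr s / of_real x"]
    by (simp add: mellin_def)
  then show ?thesis
    using set_borel_integral_eq_integral(2)[OF mellin_integrand_integrable[OF assms]] by simp
qed

text \<open>Differentiation under the integral sign: the integral runs over a compact interval of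
  positive reals, where the s-derivative of the integrand is jointly continuous in s and x.\<close>

lemma mellin_holomorphic:
  assumes "supported_on a b f"
  shows "mellin f holomorphic_on UNIV"
proof -
  note f = supported_onD[OF assms]
  have "(\<lambda>s. integral (cbox a b) (\<lambda>x. f x * of_real x powr s / of_real x)) holomorphic_on UNIV"
  proof (rule leibniz_rule_holomorphic)
    fix s :: complex and x :: real assume "x \<in> cbox a b"
    with f have "x > 0" by simp
    then show "((\<lambda>s. f x * of_real x powr s / of_real x) has_field_derivative
        f x * (of_real x powr s * Ln (of_real x)) / of_real x) (at s within UNIV)"
      by (auto intro!: derivative_eq_intros)
  next
    fix s show "(\<lambda>x. f x * of_real x powr s / of_real x) integrable_on cbox a b"
      using set_borel_integral_eq_integral(1)[OF mellin_integrand_integrable[OF assms]] by simp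
  next
    have "continuous_on (UNIV \<times> cbox a b) (\<lambda>p. f (snd p))"
      using f by (intro continuous_on_compose2[OF f(3)] continuous_intros) auto
    then have "continuous_on (UNIV \<times> cbox a b)
        (\<lambda>p. f (snd p) * (of_real (snd p) powr fst p * Ln (of_real (snd p))) / of_real (snd p))"
      using f by (intro continuous_intros) (auto simp: complex_nonpos_Reals_iff)
    then show "continuous_on (UNIV \<times> cbox a b)
        (\<lambda>(s, x). f x * (of_real x powr s * Ln (of_real x)) / of_real x)"
      by (simp add: case_prod_beta)
  qed simp
  then show ?thesis
    by (simp add: mellin_eq_integral[OF assms, abs_def])
qed

text \<open>The norm of \<open>x powr s\<close> depends on s only through its real part, so the norm
  of the integrand is a continuous function of \<open>x\<close> and \<open>Re s\<close> on a compact
  rectangle, whatever the height of s.\<close>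

lemma mellin_bounded_on_strip:
  assumes "supported_on a b f"
  obtains B where "\<And>s. Re s \<in> {c1..c2} \<Longrightarrow> norm (mellin f s) \<le> B"
proof -
  note f = supported_onD[OF assms]
  have "continuous_on ({a..b} \<times> {c1..c2}) (\<lambda>p. f (fst p))"
    using f by (intro continuous_on_compose2[OF f(3)] continuous_intros) auto
  then have "continuous_on ({a..b} \<times> {c1..c2}) (\<lambda>p. norm (f (fst p)) * fst p powr snd p / fst p)"
    using f by (intro continuous_intros) auto
  then have "bounded ((\<lambda>p. norm (f (fst p)) * fst p powr snd p / fst p) ` ({a..b} \<times> {c1..c2}))"
    by (intro compact_imp_bounded compact_continuous_image compact_Times) auto
  then obtain K where K: "\<And>x \<sigma>. x \<in> {a..b} \<Longrightarrow> \<sigma> \<in> {c1..c2} \<Longrightarrow>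
      \<bar>norm (f x) * x powr \<sigma> / x\<bar> \<le> K"
    unfolding bounded_iff by fastforce
  have "norm (mellin f s) \<le> K * (b - a)" if s: "Re s \<in> {c1..c2}" for s
    unfolding mellin_eq_integral[OF assms]
  proof (rule integral_bound)
    show "continuous_on {a..b} (\<lambda>x. f x * of_real x powr s / of_real x)"
      using f by (intro continuous_intros continuous_on_powr_of_real) auto
    fix x assume x: "x \<in> {a..b}"
    with f have "x > 0" by simp
    then show "norm (f x * of_real x powr s / of_real x) \<le> K"
      using K[OF x s] by (simp add: norm_mult norm_divide norm_powr_real_powr)
  qed (use f in auto)
  then show ?thesis by (rule that)
qed

lemma supported_on_vee:
  assumes "supported_on a b f"
  shows "supported_on (1 / b) (1 / a) (vee f)"
proof -
  note f = supported_onD[OF assms]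
  have "continuous_on {0<..} f" using assms by (simp add: supported_on_def)
  then have "continuous_on {0<..} (\<lambda>x. f (1 / x))"
    by (rule continuous_on_compose2) (auto intro!: continuous_intros)
  then have "continuous_on {0<..} (vee f)"
    unfolding vee_def by (auto intro!: continuous_intros)
  moreover have "vee f x = 0" if "x > 0" "x \<notin> {1/b..1/a}" for x
  proof -
    have "1 / x \<notin> {a..b}" using that f by (auto simp: field_simps)
    with f(4)[of "1 / x"] that show ?thesis by (simp add: vee_def)
  qed
  ultimately show ?thesis
    using f by (auto simp: supported_on_def field_simps)
qed

text \<open>Substitution x -> 1/x: the measure dx/x is preserved up to orientation, x^s becomes
  x^(-s), and the extra factor 1/x in \<open>vee\<close> produces the shift to
  \<open>1 - s\<close>.\<close>

lemma mellin_vee: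
  assumes "supported_on a b f"
  shows "mellin (vee f) s = mellin f (1 - s)"
proof -
  note f = supported_onD[OF assms]
  define h where "h = (\<lambda>x. f x * of_real x powr (1 - s) / of_real x)"
  have ab: "1 / b \<le> 1 / a" using f by (simp add: field_simps)
  have cont: "continuous_on {a..b} h"
    unfolding h_def using f by (intro continuous_intros continuous_on_powr_of_real) auto
  \<comment> \<open>The substitution rule yields an oriented integral as a difference of two terms.
    Since x -> 1/x is decreasing, the term over \<open>{a..b}\<close> is the one with the minus
    sign; the other one runs over \<open>{b..a}\<close>, which is empty or a single point.\<close>
  have "((\<lambda>x. (- 1 / x\<^sup>2) *\<^sub>R h (1 / x)) has_integral
      (integral {1 / (1 / b)..1 / (1 / a)} h - integral {1 / (1 / a)..1 / (1 / b)} h)) {1 / b..1 / a}"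
  proof (rule has_integral_substitution_general[where s = "{}" and c = a and d = b])
    have pos: "x > 0" if "x \<in> {1 / b..1 / a}" for x
      using that f by (auto intro: less_le_trans[of 0 "1 / b"])
    show "(\<lambda>x. 1 / x) ` {1 / b..1 / a} \<subseteq> {a..b}"
    proof (rule image_subsetI)
      fix x assume "x \<in> {1 / b..1 / a}"
      with pos[of x] have "x > 0" "1 / b \<le> x" "x \<le> 1 / a" by auto
      then show "1 / x \<in> {a..b}" using f(1,2) by (simp add: field_simps)
    qed
    show "continuous_on {1 / b..1 / a} ((/) 1)"
      using pos by (intro continuous_intros) fastforce
    show "((/) 1 has_field_derivative - 1 / x\<^sup>2) (at x within {1 / b..1 / a})"
      if "x \<in> {1 / b..1 / a} - {}" for x
      using pos[of x] that by (auto intro!: derivative_eq_intros simp: power2_eq_square)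
  qed (use ab cont in auto)
  then have "((\<lambda>x. (- 1 / x\<^sup>2) *\<^sub>R h (1 / x)) has_integral
      (integral {b..a} h - integral {a..b} h)) {1 / b..1 / a}" by simp
  moreover have "integral {b..a} h = 0"
    using f by (cases "a = b") auto
  ultimately have "((\<lambda>x. (- 1 / x\<^sup>2) *\<^sub>R h (1 / x)) has_integral - integral {a..b} h) {1 / b..1 / a}"
    by simp
  then have "((\<lambda>x. - ((- 1 / x\<^sup>2) *\<^sub>R h (1 / x))) has_integral - (- integral {a..b} h)) {1 / b..1 / a}"
    by (rule has_integral_neg)
  then have "((\<lambda>x. - ((- 1 / x\<^sup>2) *\<^sub>R h (1 / x))) has_integral integral {a..b} h) {1 / b..1 / a}"
    by (simp only: minus_minus)
  moreover have "- ((- 1 / x\<^sup>2) *\<^sub>R h (1 / x)) = vee f x * of_real x powr s / of_real x"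
    if "x \<in> {1 / b..1 / a}" for x
  proof -
    have x: "x > 0" using that f by (auto intro: less_le_trans[of 0 "1 / b"])
    have "complex_of_real (1 / x) powr (1 - s) = of_real (1 / x) * of_real (1 / x) powr (- s)"
      using x powr_add[of "complex_of_real (1 / x)" 1 "- s"] by simp
    also have "of_real (1 / x) powr (- s) = of_real x powr s"
      using x by (simp add: powr_def Ln_of_real ln_div del: of_real_divide)
    finally show ?thesis using x
      by (simp add: h_def vee_def power2_eq_square scaleR_conv_of_real field_simps)
  qed
  ultimately have "((\<lambda>x. vee f x * of_real x powr s / of_real x) has_integral integral {a..b} h)
      {1 / b..1 / a}"
    by (rule has_integral_eq[rotated])
  then show ?thesis
    by (simp add: mellin_eq_integral[OF assms] mellin_eq_integral[OF supported_on_vee[OF assms]]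
        integral_unique h_def)
qed

lemma smooth_compact_support_pos_supported_on:
  assumes "smooth_compact_support_pos \<phi>"
  obtains a b where "supported_on a b (\<lambda>x. of_real (\<phi> x))"
proof -
  from assms obtain K where K: "compact K" "K \<subseteq> {0<..}" "\<And>x. x > 0 \<Longrightarrow> x \<notin> K \<Longrightarrow> \<phi> x = 0"
    unfolding smooth_compact_support_pos_def by (metis DiffI greaterThan_iff)
  have "\<phi> differentiable (at x)" if "x > 0" for x
    using assms that unfolding smooth_compact_support_pos_def by (metis funpow_0)
  then have "continuous_on {0<..} \<phi>"
    by (meson continuous_at_imp_continuous_on differentiable_imp_continuous_within greaterThan_iff)
  then have cont: "continuous_on {0<..} (\<lambda>x. complex_of_real (\<phi> x))"
    by (intro continuous_intros)
  show ?thesis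
  proof (cases "K = {}")
    case True
    then show ?thesis using that[of 1 1] cont K by (auto simp: supported_on_def)
  next
    case False
    \<comment> \<open>Closedness places \<open>Inf K\<close> in \<open>K\<close>, hence in the
      positive reals; this supplies the positive left end point.\<close>
    from K False have "Inf K \<in> K"
      by (intro closed_contains_Inf compact_imp_closed bounded_imp_bdd_below compact_imp_bounded) auto
    moreover have "x \<in> {Inf K..Sup K}" if "x \<in> K" for x
      using that K by (auto intro!: cInf_lower cSup_upper bounded_imp_bdd_below
          bounded_imp_bdd_above compact_imp_bounded)
    ultimately show ?thesis using that[of "Inf K" "Sup K"] cont K(2,3)
      by (force simp: supported_on_def)
  qed
qed

section \<open>Convolution with an inverse Mellin transform\<close>

lemma mellin_line_measurable:
  assumes "supported_on a b f"
  shows "(\<lambda>t. mellin f (Complex c t)) \<in> borel_measurable lborel"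
proof -
  have "continuous_on UNIV (\<lambda>t. mellin f (Complex c t))"
    by (rule continuous_on_compose2[OF holomorphic_on_imp_continuous_on[OF mellin_holomorphic[OF assms]]])
      (auto simp: Complex_eq intro!: continuous_intros)
  then show ?thesis by (simp add: borel_measurable_continuous_onI)
qed

lemma cpowr_line_measurable [measurable]:
  "(\<lambda>t. z powr (- Complex c t)) \<in> borel_measurable lborel"
  "(\<lambda>t. z powr (Complex c t)) \<in> borel_measurable lborel"
  unfolding powr_def Complex_eq by measurable

text \<open>Write \<kappa> as its defining integral and split \<open>(x / y) powr (- s)\<close> into
  \<open>x powr (- s)\<close> and \<open>y powr s\<close>. After exchanging the integrals, the one
  over y is the Mellin transform. The factor \<i> from ds cancels the one in 1/(2 pi i).\<close>

lemma mult_conv_inverse_mellin: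
  assumes f: "supported_on a b f"
    and g: "integrable lborel (\<lambda>t. g (Complex c t))"
    and \<kappa>: "\<And>u. u > 0 \<Longrightarrow> \<kappa> u = inverse_mellin g c u"
    and x: "x > 0"
  shows "mult_conv f \<kappa> x = 1 / (2 * of_real pi) *
           (LINT t|lborel. g (Complex c t) * of_real x powr (- Complex c t) * mellin f (Complex c t))"
proof -
  note f' = supported_onD[OF f]
  define u where "u = (\<lambda>y. indicator {a..b} y *\<^sub>R (f y / of_real y))"
  define v where "v = (\<lambda>t. g (Complex c t) * of_real x powr (- Complex c t))"
  \<comment> \<open>The power y^s is written as exp (s ln y), which is visibly measurable in both
    variables jointly; the indicator inside \<open>u\<close> removes the nonpositive y, where the
    two may differ.\<close>
  define H where "H = (\<lambda>y t. u y * v t * exp (Complex c t * of_real (ln y)))"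
  have u: "integrable lborel u"
    unfolding u_def set_integrable_def[symmetric]
    using f' by (intro borel_integrable_atLeastAtMost' continuous_intros) auto
  have v: "integrable lborel v"
    unfolding v_def
  proof (rule Bochner_Integration.integrable_bound)
    show "integrable lborel (\<lambda>t. of_real (x powr (- c)) * g (Complex c t))" using g by simp
    show "(\<lambda>t. g (Complex c t) * complex_of_real x powr - Complex c t) \<in> borel_measurable lborel"
      using borel_measurable_integrable[OF g] by measurable
  qed (use x in \<open>auto simp: norm_mult norm_powr_real_powr\<close>)
  have [measurable]: "u \<in> borel_measurable borel" "v \<in> borel_measurable borel"
    using borel_measurable_integrable[OF u] borel_measurable_integrable[OF v] by auto
  \<comment> \<open>The norm splits into a function of y times a function of t, both integrable;
    this is the absolute integrability that Fubini requires.\<close>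
  have normH: "norm (H y t) = norm (u y) * y powr c * norm (v t)" for y t
  proof (cases "y \<in> {a..b}")
    case True
    with f' have "y > 0" by simp
    then show ?thesis by (simp add: H_def norm_mult powr_def mult_ac)
  qed (simp add: H_def u_def)
  have uc: "integrable lborel (\<lambda>y. norm (u y) * y powr c)"
  proof -
    have "set_integrable lborel {a..b} (\<lambda>y. norm (f y / of_real y) * y powr c)"
      using f' by (intro borel_integrable_atLeastAtMost' continuous_intros) auto
    then show ?thesis by (simp add: set_integrable_def u_def mult_ac)
  qed
  have "integrable (lborel \<Otimes>\<^sub>M lborel) (\<lambda>(y, t). H y t)"
  proof (rule lborel_pair.Fubini_integrable)
    show "(\<lambda>(y, t). H y t) \<in> borel_measurable (lborel \<Otimes>\<^sub>M lborel)"
      unfolding H_def Complex_eq by measurable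
    show "integrable lborel (\<lambda>y. LINT t|lborel. norm (case (y, t) of (y, t) \<Rightarrow> H y t))"
      using uc by (simp add: normH)
    show "AE y in lborel. integrable lborel (\<lambda>t. case (y, t) of (y, t) \<Rightarrow> H y t)"
    proof (rule AE_I2)
      fix y
      show "integrable lborel (\<lambda>t. case (y, t) of (y, t) \<Rightarrow> H y t)"
        unfolding prod.case
      proof (rule Bochner_Integration.integrable_bound)
        show "integrable lborel (\<lambda>t. of_real (norm (u y) * y powr c) * v t)" using v by simp
        show "H y \<in> borel_measurable lborel"
          unfolding H_def Complex_eq by measurable
      qed (simp add: normH norm_mult)
    qed
  qed
  then have Fubini: "(LINT t|lborel. LINT y|lborel. H y t) = (LINT y|lborel. LINT t|lborel. H y t)"
    by (rule lborel_pair.Fubini_integral)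
  have "mult_conv f \<kappa> x = (LINT y:{a..b}|lborel. f y * (\<kappa> (x / y) / of_real y))"
    using set_integral_supported_on[OF f, of "\<lambda>y. \<kappa> (x / y) / of_real y"]
    by (simp add: mult_conv_def)
  also have "\<dots> = (LINT y|lborel. 1 / (2 * of_real pi) * (LINT t|lborel. H y t))"
    unfolding set_lebesgue_integral_def
  proof (rule Bochner_Integration.integral_cong[OF refl])
    fix y
    show "indicator {a..b} y *\<^sub>R (f y * (\<kappa> (x / y) / of_real y))
        = 1 / (2 * of_real pi) * (LINT t|lborel. H y t)"
    proof (cases "y \<in> {a..b}")
      case True
      with f' have y: "y > 0" by simp
      have "of_real (x / y) powr (- Complex c t)
          = of_real x powr (- Complex c t) * exp (Complex c t * of_real (ln y))" for t
        using x y by (simp add: powr_def Ln_of_real ln_div exp_add[symmetric] algebra_simps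
            del: of_real_divide)
      then have "H y t = (f y / of_real y) * (g (Complex c t) * of_real (x / y) powr (- Complex c t))" for t
        using True by (simp add: H_def u_def v_def mult_ac)
      then have "(LINT t|lborel. H y t) = (f y / of_real y) *
          (LINT t|lborel. g (Complex c t) * of_real (x / y) powr (- Complex c t))"
        by simp
      with True x y show ?thesis
        by (simp add: \<kappa> inverse_mellin_def vertical_integral_def)
    qed (simp add: H_def u_def)
  qed
  also have "\<dots> = 1 / (2 * of_real pi) * (LINT t|lborel. LINT y|lborel. H y t)"
    by (simp add: Fubini)
  also have "(\<lambda>t. LINT y|lborel. H y t) = (\<lambda>t. v t * mellin f (Complex c t))"
  proof
    fix t
    have "(LINT y|lborel. H y t) =
        (LINT y|lborel. v t * (indicator {a..b} y *\<^sub>R (f y * (of_real y powr Complex c t / of_real y))))"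
    proof (rule Bochner_Integration.integral_cong[OF refl])
      fix y
      show "H y t = v t * (indicator {a..b} y *\<^sub>R (f y * (of_real y powr Complex c t / of_real y)))"
      proof (cases "y \<in> {a..b}")
        case True
        with f' have "y > 0" by simp
        then show ?thesis using True by (simp add: H_def u_def powr_def Ln_of_real mult_ac)
      qed (simp add: H_def u_def)
    qed
    also have "\<dots> = v t * (LINT y:{a..b}|lborel. f y * (of_real y powr Complex c t / of_real y))"
      unfolding set_lebesgue_integral_def by (rule integral_mult_right_zero)
    also have "\<dots> = v t * mellin f (Complex c t)"
      using set_integral_supported_on[OF f, of "\<lambda>y. of_real y powr Complex c t / of_real y"]
      by (simp add: mellin_def)
    finally show "(LINT y|lborel. H y t) = v t * mellin f (Complex c t)" .
  qed
  finally show ?thesis by (simp add: v_def)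
qed

section \<open>Termwise integration of Dirichlet series\<close>

lemma norm_of_nat_Suc_powr: "norm (of_nat (Suc n) powr s :: complex) = real (Suc n) powr Re s"
  using norm_powr_real_powr[of "real (Suc n)" s] by (simp del: of_nat_Suc)

text \<open>Convergence at \<open>s0\<close> makes the terms there bounded, so at c they are
  dominated by a multiple of n^(Re s0 - c), whose exponent lies below -1.\<close>

lemma dirichlet_series_abs_summable:
  fixes d :: "nat \<Rightarrow> complex"
  assumes conv: "summable (\<lambda>n. d (Suc n) * of_nat (Suc n) powr (- s0))"
    and c: "c > Re s0 + 1"
  shows "summable (\<lambda>n. norm (d (Suc n)) * real (Suc n) powr (- c))"
proof -
  have "Bseq (\<lambda>n. d (Suc n) * of_nat (Suc n) powr (- s0))"
    by (rule convergent_imp_Bseq) (use summable_LIMSEQ_zero[OF conv] in \<open>auto simp: convergent_def\<close>)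
  then obtain K where K: "\<And>n. norm (d (Suc n)) * real (Suc n) powr (- Re s0) \<le> K"
    unfolding Bseq_def norm_mult norm_of_nat_Suc_powr by auto
  have "summable (\<lambda>n. K * real (Suc n) powr (Re s0 - c))"
    by (intro summable_mult, subst summable_Suc_iff) (use c in \<open>simp add: summable_real_powr_iff\<close>)
  then show ?thesis
  proof (rule summable_comparison_test'[where N = 0])
    fix n
    have "real (Suc n) powr (- c) = real (Suc n) powr (- Re s0) * real (Suc n) powr (Re s0 - c)"
      by (simp add: powr_add[symmetric])
    then show "norm (norm (d (Suc n)) * real (Suc n) powr (- c)) \<le> K * real (Suc n) powr (Re s0 - c)"
      using mult_right_mono[OF K[of n], of "real (Suc n) powr (Re s0 - c)"] by (simp add: mult_ac)
  qed
qed

text \<open>On the line the terms of the series have norms that are constants times one integrable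
  function of t, and these constants are summable. Hence sum and integral may be interchanged, and
  the sum under the integral is D.\<close>

lemma dirichlet_mult_conv_sums:
  fixes d :: "nat \<Rightarrow> complex"
  assumes f: "supported_on a b f"
    and g: "integrable lborel (\<lambda>t. g (Complex c t))"
    and \<kappa>: "\<And>u. u > 0 \<Longrightarrow> \<kappa> u = inverse_mellin g c u"
    and abs: "summable (\<lambda>n. norm (d (Suc n)) * real (Suc n) powr (- c))"
    and D: "\<And>t. (\<lambda>n. d (Suc n) * of_nat (Suc n) powr (- Complex c t)) sums D (Complex c t)"
  shows "integrable lborel (\<lambda>t. g (Complex c t) * D (Complex c t) * mellin f (Complex c t))"
    and "(\<lambda>n. d (Suc n) * mult_conv f \<kappa> (real (Suc n))) sums
     (1 / (2 * of_real pi) *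
       (LINT t|lborel. g (Complex c t) * D (Complex c t) * mellin f (Complex c t)))"
proof -
  obtain B where B: "\<And>s. Re s \<in> {c..c} \<Longrightarrow> norm (mellin f s) \<le> B"
    using mellin_bounded_on_strip[OF f] by blast
  define h where "h = (\<lambda>t. g (Complex c t) * mellin f (Complex c t))"
  have h: "integrable lborel h"
    unfolding h_def
  proof (rule Bochner_Integration.integrable_bound)
    show "integrable lborel (\<lambda>t. of_real B * g (Complex c t))" using g by simp
    show "(\<lambda>t. g (Complex c t) * mellin f (Complex c t)) \<in> borel_measurable lborel"
      using borel_measurable_integrable[OF g] mellin_line_measurable[OF f] by measurable
    have "norm (mellin f (Complex c t)) \<le> \<bar>B\<bar>" for t
      using B[of "Complex c t"] by auto
    then show "AE t in lborel. norm (g (Complex c t) * mellin f (Complex c t))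
        \<le> norm (of_real B * g (Complex c t))"
      by (intro AE_I2) (subst mult.commute, auto simp: norm_mult intro: mult_right_mono)
  qed
  define F where "F = (\<lambda>n t. d (Suc n) * of_nat (Suc n) powr (- Complex c t) * h t)"
  have normF: "norm (F n t) = norm (d (Suc n)) * real (Suc n) powr (- c) * norm (h t)" for n t
    unfolding F_def norm_mult norm_of_nat_Suc_powr by simp
  have F: "integrable lborel (F n)" for n
  proof (rule Bochner_Integration.integrable_bound)
    show "integrable lborel (\<lambda>t. of_real (norm (d (Suc n)) * real (Suc n) powr (- c)) * h t)"
      using h by simp
    show "F n \<in> borel_measurable lborel"
      unfolding F_def using borel_measurable_integrable[OF h] by measurable
  qed (simp add: normF norm_mult)
  have sums: "(\<lambda>n. F n t) sums (D (Complex c t) * h t)" for t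
    unfolding F_def by (intro sums_mult2 D)
  have suminf: "(\<Sum>n. F n t) = g (Complex c t) * D (Complex c t) * mellin f (Complex c t)" for t
    using sums_unique[OF sums[of t]] by (simp add: h_def mult_ac)
  have S1: "AE t in lborel. summable (\<lambda>n. norm (F n t))"
    unfolding normF by (intro AE_I2 summable_mult2 abs)
  have S2: "summable (\<lambda>n. LINT t|lborel. norm (F n t))"
    unfolding normF by (simp del: of_nat_Suc, intro summable_mult2 abs)
  show "integrable lborel (\<lambda>t. g (Complex c t) * D (Complex c t) * mellin f (Complex c t))"
    using integrable_suminf[OF F S1 S2] by (simp add: suminf)
  have "(\<lambda>n. 1 / (2 * of_real pi) * (LINT t|lborel. F n t)) sums
      (1 / (2 * of_real pi) * (LINT t|lborel. (\<Sum>n. F n t)))"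
    by (intro sums_mult sums_integral F S1 S2)
  moreover have "1 / (2 * of_real pi) * (LINT t|lborel. F n t) = d (Suc n) * mult_conv f \<kappa> (real (Suc n))" for n
  proof -
    have "(LINT t|lborel. F n t) = d (Suc n) *
      (LINT t|lborel. g (Complex c t) * of_real (real (Suc n)) powr (- Complex c t) * mellin f (Complex c t))"
      unfolding integral_mult_right_zero[symmetric]
      by (simp add: F_def h_def mult_ac del: of_nat_Suc)
    then show ?thesis
      by (simp add: mult_conv_inverse_mellin[OF f g \<kappa>] del: of_nat_Suc)
  qed
  ultimately show "(\<lambda>n. d (Suc n) * mult_conv f \<kappa> (real (Suc n))) sums
     (1 / (2 * of_real pi) *
       (LINT t|lborel. g (Complex c t) * D (Complex c t) * mellin f (Complex c t)))"
    by (simp only: suminf)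
qed

subsection \<open>Residues and rectangles\<close>

text \<open>Near a pole the norm would tend to infinity along S as well, so a bound along S excludes
  a pole; it then passes to the limit at z. This carries a bound on raw values over to the function
  with its removable singularities filled in.\<close>

lemma meromorphic_bounded_on_limpt:
  assumes f: "f meromorphic_on {z}" and z: "z islimpt S"
    and B: "\<And>w. w \<in> S \<Longrightarrow> norm (f w) \<le> B"
  shows "\<not> is_pole f z" "norm (remove_sings f z) \<le> B"
proof -
  have bot: "at z within S \<noteq> bot"
    using z by (simp add: trivial_limit_within)
  have ev: "eventually (\<lambda>w. norm (f w) \<le> B) (at z within S)"
    using B by (auto simp: eventually_at_filter)
  show not_pole: "\<not> is_pole f z"
  proof
    assume "is_pole f z"
    then have "filterlim f at_infinity (at z within S)"
      unfolding is_pole_def by (rule filterlim_mono) (auto intro: at_le)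
    then have "eventually (\<lambda>w. norm (f w) \<ge> \<bar>B\<bar> + 1) (at z within S)"
      by (subst (asm) filterlim_at_infinity[of 0]) auto
    with ev have "eventually (\<lambda>w. False) (at z within S)"
      by eventually_elim linarith
    with bot show False by simp
  qed
  with meromorphic_on_not_essential[OF f] obtain c where c: "f \<midarrow>z\<rightarrow> c"
    unfolding not_essential_def by blast
  then have "(f \<longlongrightarrow> c) (at z within S)"
    by (rule tendsto_within_subset) auto
  then have "norm c \<le> B"
    by (intro tendsto_upperbound[OF tendsto_norm ev bot])
  with c show "norm (remove_sings f z) \<le> B"
    by (simp add: remove_sings_eqI)
qed

lemma residue_sum:
  assumes "finite A" "open s" "z \<in> s" "\<And>m. m \<in> A \<Longrightarrow> F m holomorphic_on s - {z}"
  shows "residue (\<lambda>w. \<Sum>m\<in>A. F m w) z = (\<Sum>m\<in>A. residue (F m) z)"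
  using assms(1,4)
proof (induction A rule: finite_induct)
  case (insert m A)
  then have "residue (\<lambda>w. F m w + (\<Sum>m\<in>A. F m w)) z
      = residue (F m) z + residue (\<lambda>w. \<Sum>m\<in>A. F m w) z"
    by (intro residue_add[OF assms(2,3)] holomorphic_on_sum) auto
  with insert show ?case by simp
qed (simp add: residue_const)

text \<open>Riemann's theorem on removable singularities: near z, h agrees with a function
  holomorphic at z.\<close>

lemma residue_bounded:
  assumes s: "open s" "z \<in> s" "h holomorphic_on s - {z}" "h \<in> O[at z](\<lambda>_. 1)"
  shows "residue h z = 0"
proof -
  obtain k where k: "k holomorphic_on s" "\<forall>w\<in>s - {z}. k w = h w"
    using holomorphic_on_extend[OF s(3) _ s(4)] s(1,2) by (auto simp: interior_open)
  have "eventually (\<lambda>w. w \<in> s - {z}) (at z)"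
    using s(1,2) by (rule eventually_at_in_open)
  then have "eventually (\<lambda>w. h w = k w) (at z)"
    by eventually_elim (use k in auto)
  then have "residue h z = residue k z" by (rule residue_cong) simp
  then show ?thesis using residue_holo[OF s(1,2) k(1)] by simp
qed

text \<open>Split f into its principal part and a bounded remainder. The remainder times g stays
  bounded and has residue 0, and the residue of g(s) / (s - z)^m is the Taylor coefficient of g at z
  of order m - 1.\<close>

lemma residue_principal_part_mult:
  assumes f: "isolated_singularity_at f z"
    and P: "(\<lambda>s. f s - (\<Sum>m=1..N. c m / (s - z) ^ m)) \<in> O[at z](\<lambda>_. 1)"
    and g: "g holomorphic_on UNIV"
  shows "residue (\<lambda>s. f s * g s) z = (\<Sum>m=1..N. c m / fact (m - 1) * (deriv ^^ (m - 1)) g z)"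
proof -
  obtain r where r: "r > 0" "f analytic_on ball z r - {z}"
    using f by (auto simp: isolated_singularity_at_def)
  then have fh: "f holomorphic_on ball z r - {z}" by (simp add: analytic_imp_holomorphic)
  have gs: "g holomorphic_on S" for S using g by (rule holomorphic_on_subset) simp
  define F where "F = (\<lambda>m s. c m * (g s / (s - z) ^ m))"
  define h where "h = (\<lambda>s. (f s - (\<Sum>m=1..N. c m / (s - z) ^ m)) * g s)"
  have F: "F m holomorphic_on ball z r - {z}" for m
    unfolding F_def by (intro holomorphic_intros gs) auto
  have h: "h holomorphic_on ball z r - {z}"
    unfolding h_def by (intro holomorphic_intros gs fh) auto
  have "isCont g z"
    using g by (simp add: holomorphic_on_imp_continuous_on continuous_on_eq_continuous_at[OF open_UNIV, THEN iffD1])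
  then have "g \<in> O[at z](\<lambda>_. 1)"
    by (intro bigoI_tendsto[where c = "g z"]) (auto simp: isCont_def)
  then have "h \<in> O[at z](\<lambda>_. 1 * 1)"
    unfolding h_def by (rule landau_o.big.mult[OF P])
  then have res0: "residue h z = 0"
    using r h by (intro residue_bounded[of "ball z r"]) auto
  have "(\<lambda>s. f s * g s) = (\<lambda>s. h s + (\<Sum>m=1..N. F m s))"
    by (simp add: h_def F_def sum_distrib_left sum_distrib_right algebra_simps)
  then have "residue (\<lambda>s. f s * g s) z = residue h z + residue (\<lambda>s. \<Sum>m=1..N. F m s) z"
    using r by (simp only:) (intro residue_add[of "ball z r"] h holomorphic_on_sum F, auto)
  also have "\<dots> = (\<Sum>m=1..N. residue (F m) z)"
    using r by (simp add: res0, intro residue_sum[of _ "ball z r"] F, auto)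
  also have "\<dots> = (\<Sum>m=1..N. c m / fact (m - 1) * (deriv ^^ (m - 1)) g z)"
  proof (rule sum.cong[OF refl])
    fix m assume "m \<in> {1..N}"
    then obtain n where m: "m = Suc n" by (cases m) auto
    have "residue (F m) z = c m * residue (\<lambda>s. g s / (s - z) ^ m) z"
      unfolding F_def by (rule residue_lmul[of UNIV]) (auto intro!: holomorphic_intros gs)
    also have "residue (\<lambda>s. g s / (s - z) ^ m) z = (deriv ^^ n) g z / fact n"
      unfolding m by (rule residue_holomorphic_over_power[OF open_UNIV _ g]) simp
    finally show "residue (F m) z = c m / fact (m - 1) * (deriv ^^ (m - 1)) g z"
      by (simp add: m)
  qed
  finally show ?thesis .
qed

section \<open>Contour integrals over rectangles\<close>

lemma contour_integral_rectpath:
  assumes f: "continuous_on (path_image (rectpath (Complex x0 y0) (Complex x1 y1))) f"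
    and le: "x0 \<le> x1" "y0 < y1"
  shows "contour_integral (rectpath (Complex x0 y0) (Complex x1 y1)) f =
      contour_integral (linepath (Complex x0 y0) (Complex x1 y0)) f
      + \<i> * integral {y0..y1} (\<lambda>y. f (Complex x1 y))
      - contour_integral (linepath (Complex x0 y1) (Complex x1 y1)) f
      - \<i> * integral {y0..y1} (\<lambda>y. f (Complex x0 y))"
proof -
  let ?a = "Complex x0 y0" and ?b = "Complex x1 y0" and ?c = "Complex x1 y1" and ?d = "Complex x0 y1"
  have "path_image (rectpath ?a ?c) = closed_segment ?a ?b \<union> closed_segment ?b ?c \<union>
      closed_segment ?c ?d \<union> closed_segment ?d ?a"
    by (simp add: rectpath_def Let_def path_image_join Un_assoc)
  with f have cont: "continuous_on (closed_segment ?a ?b) f" "continuous_on (closed_segment ?b ?c) f"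
    "continuous_on (closed_segment ?c ?d) f" "continuous_on (closed_segment ?d ?a) f"
    by (auto intro: continuous_on_subset)
  note int = cont[THEN contour_integrable_continuous_linepath]
  have "contour_integral (rectpath ?a ?c) f = contour_integral (linepath ?a ?b) f
      + (contour_integral (linepath ?b ?c) f + (contour_integral (linepath ?c ?d) f
      + contour_integral (linepath ?d ?a) f))"
    unfolding rectpath_def Let_def complex.sel
    using int by (simp add: contour_integral_join)
  \<comment> \<open>The rectangle path traverses its top and left sides backwards; reversing them
    produces the two minus signs.\<close>
  also have "contour_integral (linepath ?c ?d) f = - contour_integral (linepath ?d ?c) f"
    using cont(3) by (intro contour_integral_reverse_linepath) (simp add: closed_segment_commute)
  also have "contour_integral (linepath ?d ?a) f = - contour_integral (linepath ?a ?d) f"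
    using cont(4) by (intro contour_integral_reverse_linepath) (simp add: closed_segment_commute)
  also have "contour_integral (linepath ?a ?d) f = \<i> * integral {y0..y1} (\<lambda>y. f (Complex x0 y))"
    using le by (intro contour_integral_linepath_same_Re) auto
  also have "contour_integral (linepath ?b ?c) f = \<i> * integral {y0..y1} (\<lambda>y. f (Complex x1 y))"
    using le by (intro contour_integral_linepath_same_Re) auto
  finally show ?thesis by (simp add: algebra_simps)
qed

lemma sparse_poles:
  assumes "f meromorphic_on UNIV"
  shows "{z. is_pole f z} sparse_in UNIV"
  using meromorphic_on_imp_not_pole_cosparse[OF assms] by (simp add: eventually_cosparse)

text \<open>A sparse set meets a compact set in finitely many points, and the poles in question are
  confined to a compact rectangle.\<close>

lemma finite_poles_rectangle:
  assumes "f meromorphic_on UNIV" and "\<And>z. is_pole f z \<Longrightarrow> \<bar>Re z - x\<bar> \<le> w"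
  shows "finite {z. is_pole f z \<and> \<bar>Im z\<bar> < T}"
proof -
  have "{z. is_pole f z} sparse_in cbox (Complex (x - w) (- T)) (Complex (x + w) T)"
    using sparse_poles[OF assms(1)] by (rule sparse_in_subset) simp
  then have "finite (cbox (Complex (x - w) (- T)) (Complex (x + w) T) \<inter> {z. is_pole f z})"
    by (rule sparse_in_compact_finite) simp
  moreover have "{z. is_pole f z \<and> \<bar>Im z\<bar> < T}
      \<subseteq> cbox (Complex (x - w) (- T)) (Complex (x + w) T) \<inter> {z. is_pole f z}"
    using assms(2) by (auto simp: in_cbox_complex_iff abs_le_iff abs_less_iff) (smt (verit))+
  ultimately show ?thesis by (rule rev_finite_subset)
qed

text \<open>Being nicely meromorphic, f is analytic off its poles, so the contour, which the
  hypotheses keep away from the poles, lies where the integrand is holomorphic, and the residue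
  theorem applies.\<close>

lemma contour_integral_rectpath_residues:
  assumes f: "f nicely_meromorphic_on UNIV" and g: "g holomorphic_on UNIV"
    and strip: "\<And>z. is_pole f z \<Longrightarrow> \<bar>Re z - x\<bar> < u"
    and height: "\<And>z. is_pole f z \<Longrightarrow> \<bar>Im z\<bar> \<noteq> T"
    and T: "T > 0" and u: "u > 0"
  shows "contour_integral (rectpath (Complex (x - u) (- T)) (Complex (x + u) T)) (\<lambda>s. f s * g s)
      = 2 * of_real pi * \<i> * (\<Sum>z | is_pole f z \<and> \<bar>Im z\<bar> < T. residue (\<lambda>s. f s * g s) z)"
    and "continuous_on (path_image (rectpath (Complex (x - u) (- T)) (Complex (x + u) T))) (\<lambda>s. f s * g s)"
proof -
  \<comment> \<open>This open horizontal strip leaves room around the contour, is convex and still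
    contains only finitely many poles.\<close>
  define S where "S = {z. \<bar>Im z\<bar> < T + 1}"
  define pts where "pts = {z. is_pole f z \<and> \<bar>Im z\<bar> < T + 1}"
  let ?p = "rectpath (Complex (x - u) (- T)) (Complex (x + u) T)"
  have holo: "(\<lambda>s. f s * g s) holomorphic_on A" if "\<And>z. z \<in> A \<Longrightarrow> \<not> is_pole f z" for A
  proof -
    have "f analytic_on A"
      using that nicely_meromorphic_on_subset[OF f] by (intro nicely_meromorphic_without_singularities) auto
    then show ?thesis
      by (intro holomorphic_intros analytic_imp_holomorphic holomorphic_on_subset[OF g]) auto
  qed
  have fin: "finite pts"
    unfolding pts_def using f strip
    by (intro finite_poles_rectangle[where x = x and w = u])
      (auto simp: nicely_meromorphic_on_def intro: less_imp_le)
  have path: "path_image ?p \<subseteq> S - {z. is_pole f z}"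
    using T u strip height unfolding S_def by (fastforce simp: path_image_rectpath)
  have "S = {z. Im z < T + 1} \<inter> {z. Im z > - (T + 1)}" by (auto simp: S_def)
  then have S: "open S" "connected S"
    by (auto intro!: open_Int open_halfspace_Im_lt open_halfspace_Im_gt convex_connected convex_Int
        convex_halfspace_Im_lt convex_halfspace_Im_gt)
  have "contour_integral ?p (\<lambda>s. f s * g s) =
      2 * pi * \<i> * (\<Sum>z\<in>pts. winding_number ?p z * residue (\<lambda>s. f s * g s) z)"
  proof (rule Residue_theorem[OF S fin])
    show "(\<lambda>s. f s * g s) holomorphic_on S - pts" by (rule holo) (auto simp: S_def pts_def)
    show "path_image ?p \<subseteq> S - pts" using path by (auto simp: pts_def)
    show "\<forall>z. z \<notin> S \<longrightarrow> winding_number ?p z = 0"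
      using T u by (auto intro!: winding_number_rectpath_outside simp: S_def in_cbox_complex_iff)
  qed auto
  \<comment> \<open>Poles above or below the rectangle have winding number 0 and drop out; the
    others lie in its interior and have winding number 1.\<close>
  also have "(\<Sum>z\<in>pts. winding_number ?p z * residue (\<lambda>s. f s * g s) z)
      = (\<Sum>z | is_pole f z \<and> \<bar>Im z\<bar> < T. residue (\<lambda>s. f s * g s) z)"
  proof (rule sum.mono_neutral_cong_right[OF fin])
    show "{z. is_pole f z \<and> \<bar>Im z\<bar> < T} \<subseteq> pts" by (auto simp: pts_def)
    show "\<forall>z\<in>pts - {z. is_pole f z \<and> \<bar>Im z\<bar> < T}. winding_number ?p z * residue (\<lambda>s. f s * g s) z = 0"
    proof
      fix z assume "z \<in> pts - {z. is_pole f z \<and> \<bar>Im z\<bar> < T}"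
      then have "z \<notin> cbox (Complex (x - u) (- T)) (Complex (x + u) T)"
        using height[of z] by (auto simp: pts_def in_cbox_complex_iff)
      then show "winding_number ?p z * residue (\<lambda>s. f s * g s) z = 0"
        using T u by (simp add: winding_number_rectpath_outside)
    qed
    fix z assume "z \<in> {z. is_pole f z \<and> \<bar>Im z\<bar> < T}"
    with strip[of z] have "z \<in> box (Complex (x - u) (- T)) (Complex (x + u) T)"
      by (auto simp: in_box_complex_iff)
    then show "winding_number ?p z * residue (\<lambda>s. f s * g s) z = residue (\<lambda>s. f s * g s) z"
      by (simp add: winding_number_rectpath)
  qed
  finally show "contour_integral ?p (\<lambda>s. f s * g s)
      = 2 * of_real pi * \<i> * (\<Sum>z | is_pole f z \<and> \<bar>Im z\<bar> < T. residue (\<lambda>s. f s * g s) z)"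
    by simp
  show "continuous_on (path_image ?p) (\<lambda>s. f s * g s)"
    using path by (intro holomorphic_on_imp_continuous_on holo) auto
qed

text \<open>An identity valid off a sparse set holds on a punctured neighbourhood of every point,
  hence between the limits there; filling in the removable singularities makes it hold
  everywhere.\<close>

lemma remove_sings_reflection:
  assumes f: "f meromorphic_on UNIV" and eq: "\<forall>\<^sub>\<approx>s\<in>UNIV. f s = \<epsilon> * f (1 - s)" and "\<epsilon> \<noteq> 0"
  shows "remove_sings f s = \<epsilon> * remove_sings f (1 - s)"
proof -
  have ev: "eventually (\<lambda>w. f w = \<epsilon> * f (1 - w)) (at s)"
    using eventually_cosparse_imp_eventually_at[OF eq] by simp
  have lim: "filterlim (\<lambda>w. 1 - w) (at (1 - s)) (at s)"
    by (auto simp: filterlim_at eventually_at_filter intro!: tendsto_intros)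
  have "not_essential f (1 - s)"
    using f by (intro meromorphic_on_not_essential) (auto intro: meromorphic_on_subset)
  then consider c where "f \<midarrow>1 - s\<rightarrow> c" | "is_pole f (1 - s)"
    unfolding not_essential_def by blast
  then show ?thesis
  proof cases
    case 1
    have "(\<lambda>w. \<epsilon> * f (1 - w)) \<midarrow>s\<rightarrow> \<epsilon> * c"
      by (intro tendsto_intros filterlim_compose[OF 1 lim])
    then have "f \<midarrow>s\<rightarrow> \<epsilon> * c"
      using tendsto_cong[OF ev] by blast
    with 1 show ?thesis by (simp add: remove_sings_eqI)
  next
    case 2
    have "is_pole (\<lambda>w. f (1 - w)) s"
      using filterlim_compose[OF 2[unfolded is_pole_def] lim] by (simp add: is_pole_def)
    then have "is_pole (\<lambda>w. \<epsilon> * f (1 - w)) s" using \<open>\<epsilon> \<noteq> 0\<close> by simp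
    then have "is_pole f s" using is_pole_cong[OF ev] by blast
    \<comment> \<open>At a pole \<open>remove_sings\<close> has the default value 0, so both sides
      vanish.\<close>
    with 2 show ?thesis by simp
  qed
qed

section \<open>Passage to rectangles of infinite height\<close>

lemma integral_symmetric_interval_tendsto:
  fixes h :: "real \<Rightarrow> complex"
  assumes h: "integrable lborel h" and t: "filterlim t at_top sequentially"
  shows "(\<lambda>k. integral {- t k..t k} h) \<longlonglongrightarrow> (LINT y|lborel. h y)"
proof -
  have "set_integrable lborel {- t k..t k} h" for k
    unfolding set_integrable_def using h by (intro integrable_mult_indicator) auto
  then have eq: "integral {- t k..t k} h = (LINT y|lborel. indicator {- t k..t k} y *\<^sub>R h y)" for k
    using set_borel_integral_eq_integral(2) by (metis set_lebesgue_integral_def)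
  have "(\<lambda>k. LINT y|lborel. indicator {- t k..t k} y *\<^sub>R h y) \<longlonglongrightarrow> (LINT y|lborel. h y)"
  proof (rule integral_dominated_convergence)
    show "integrable lborel (\<lambda>y. norm (h y))" using h by simp
    show "AE y in lborel. (\<lambda>k. indicator {- t k..t k} y *\<^sub>R h y) \<longlonglongrightarrow> h y"
    proof (rule AE_I2)
      fix y
      have "eventually (\<lambda>k. t k \<ge> \<bar>y\<bar>) sequentially"
        using t by (simp add: filterlim_at_top)
      then have "eventually (\<lambda>k. indicator {- t k..t k} y *\<^sub>R h y = h y) sequentially"
        by eventually_elim (auto simp: indicator_def)
      then show "(\<lambda>k. indicator {- t k..t k} y *\<^sub>R h y) \<longlonglongrightarrow> h y"
        by (rule tendsto_eventually)
    qed
    show "AE y in lborel. norm (indicator {- t k..t k} y *\<^sub>R h y) \<le> norm (h y)" for k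
      by (auto simp: indicator_def)
  qed (use borel_measurable_integrable[OF h] in measurable)
  then show ?thesis by (simp add: eq)
qed

text \<open>Apply the residue theorem to rectangles with sides on Re s = c and Re s = 1 - c. The
  functional equation carries the left side to the line Re s = c with g reflected. It also extends
  the bound \<open>E\<close> from the right half of the horizontal sides to the left half, so these
  sides vanish in the limit.\<close>

lemma residue_sum_tendsto:
  assumes f: "f nicely_meromorphic_on UNIV" and g: "g holomorphic_on UNIV"
    and fe: "\<And>s. f s = \<epsilon> * f (1 - s)" and \<epsilon>: "norm \<epsilon> = 1"
    and c: "c > 1 / 2"
    and strip: "\<And>z. is_pole f z \<Longrightarrow> \<bar>Re z - 1 / 2\<bar> < c - 1 / 2"
    and t: "\<And>k. t k > 0" "filterlim t at_top sequentially"
    and height: "eventually (\<lambda>k. \<forall>z. is_pole f z \<longrightarrow> \<bar>Im z\<bar> \<noteq> t k) sequentially"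
    and E: "eventually (\<lambda>k. \<forall>\<sigma>\<in>{1 / 2..c}. \<forall>y. \<bar>y\<bar> = t k \<longrightarrow> norm (f (Complex \<sigma> y)) \<le> E k) sequentially"
      "E \<longlonglongrightarrow> 0"
    and G: "\<And>s. Re s \<in> {1 - c..c} \<Longrightarrow> norm (g s) \<le> G"
    and int1: "integrable lborel (\<lambda>y. f (Complex c y) * g (Complex c y))"
    and int2: "integrable lborel (\<lambda>y. f (Complex c y) * g (1 - Complex c y))"
  shows "(\<lambda>k. \<Sum>z | is_pole f z \<and> \<bar>Im z\<bar> < t k. residue (\<lambda>s. f s * g s) z) \<longlonglongrightarrow>
      1 / (2 * of_real pi) * (LINT y|lborel. f (Complex c y) * g (Complex c y))
      - \<epsilon> * (1 / (2 * of_real pi) * (LINT y|lborel. f (Complex c y) * g (1 - Complex c y)))"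
proof -
  let ?F = "\<lambda>s. f s * g s"
  define H where "H = (\<lambda>y. contour_integral (linepath (Complex (1 - c) y) (Complex c y)) ?F)"
  define V1 where "V1 = (\<lambda>T. integral {- T..T} (\<lambda>y. f (Complex c y) * g (Complex c y)))"
  define V2 where "V2 = (\<lambda>T. integral {- T..T} (\<lambda>y. f (Complex c y) * g (1 - Complex c y)))"
  \<comment> \<open>For s on the left line, 1 - s is the point of the right line at the opposite
    height; the sign of y disappears because the interval is symmetric.\<close>
  have left: "integral {- T..T} (\<lambda>y. ?F (Complex (1 - c) y)) = \<epsilon> * V2 T" for T
  proof -
    have "1 - Complex (1 - c) y = Complex c (- y)" for y by (simp add: complex_eq_iff)
    moreover have "1 - Complex c (- y) = Complex (1 - c) y" for y by (simp add: complex_eq_iff)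
    ultimately have "?F (Complex (1 - c) y) = \<epsilon> * (f (Complex c (- y)) * g (1 - Complex c (- y)))" for y
      using fe[of "Complex (1 - c) y"] by simp
    then have "integral {- T..T} (\<lambda>y. ?F (Complex (1 - c) y))
        = \<epsilon> * integral {- T..T} (\<lambda>y. f (Complex c (- y)) * g (1 - Complex c (- y)))"
      by simp
    also have "integral {- T..T} (\<lambda>y. f (Complex c (- y)) * g (1 - Complex c (- y))) = V2 T"
      using Henstock_Kurzweil_Integration.integral_reflect_real
        [of T "- T" "\<lambda>y. f (Complex c y) * g (1 - Complex c y)"] by (simp add: V2_def)
    finally show ?thesis .
  qed
  have residues: "(\<Sum>z | is_pole f z \<and> \<bar>Im z\<bar> < T. residue ?F z) = 1 / (2 * of_real pi) * V1 T
      - \<epsilon> * (1 / (2 * of_real pi) * V2 T) + (H (- T) - H T) / (2 * of_real pi * \<i>)"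
    and continuous: "\<bar>y\<bar> = T \<Longrightarrow> continuous_on (closed_segment (Complex (1 - c) y) (Complex c y)) ?F"
    if T: "T > 0" "\<forall>z. is_pole f z \<longrightarrow> \<bar>Im z\<bar> \<noteq> T" for T y
  proof -
    let ?p = "rectpath (Complex (1 - c) (- T)) (Complex c T)"
    have c': "1 / 2 - (c - 1 / 2) = 1 - c" "1 / 2 + (c - 1 / 2) = c" by simp_all
    have *: "contour_integral ?p ?F =
        2 * of_real pi * \<i> * (\<Sum>z | is_pole f z \<and> \<bar>Im z\<bar> < T. residue ?F z)"
      "continuous_on (path_image ?p) ?F"
      using contour_integral_rectpath_residues[OF f g strip, of T] T c unfolding c' by auto
    have "contour_integral ?p ?F = H (- T) + \<i> * V1 T - H T - \<i> * (\<epsilon> * V2 T)"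
      using contour_integral_rectpath[OF *(2)] T c by (simp add: H_def V1_def left)
    with *(1) have "(\<Sum>z | is_pole f z \<and> \<bar>Im z\<bar> < T. residue ?F z)
        = (H (- T) + \<i> * V1 T - H T - \<i> * (\<epsilon> * V2 T)) / (2 * of_real pi * \<i>)"
      by simp
    also have "\<dots> = 1 / (2 * of_real pi) * V1 T
      - \<epsilon> * (1 / (2 * of_real pi) * V2 T) + (H (- T) - H T) / (2 * of_real pi * \<i>)"
      by (simp add: divide_simps) (simp add: algebra_simps)
    finally show "(\<Sum>z | is_pole f z \<and> \<bar>Im z\<bar> < T. residue ?F z) = 1 / (2 * of_real pi) * V1 T
      - \<epsilon> * (1 / (2 * of_real pi) * V2 T) + (H (- T) - H T) / (2 * of_real pi * \<i>)" .
    assume "\<bar>y\<bar> = T"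
    then have "closed_segment (Complex (1 - c) y) (Complex c y) \<subseteq> path_image ?p"
      using T c by (auto simp: path_image_rectpath closed_segment_same_Im closed_segment_eq_real_ivl)
    then show "continuous_on (closed_segment (Complex (1 - c) y) (Complex c y)) ?F"
      using *(2) continuous_on_subset by blast
  qed
  have "G \<ge> 0" using order_trans[OF norm_ge_zero G[of "of_real c"]] c by simp
  \<comment> \<open>The choices r = 1 and r = -1 treat the top and the bottom side at once.\<close>
  have H0: "(\<lambda>k. H (r * t k)) \<longlonglongrightarrow> 0" if r: "\<bar>r\<bar> = 1" for r
  proof (rule Lim_null_comparison)
    show "(\<lambda>k. E k * G * (2 * c - 1)) \<longlonglongrightarrow> 0"
      using tendsto_mult_left[OF E(2), of "G * (2 * c - 1)"] by (simp add: mult_ac)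
    show "eventually (\<lambda>k. norm (H (r * t k)) \<le> E k * G * (2 * c - 1)) sequentially"
      using height E(1)
    proof eventually_elim
      case (elim k)
      define y where "y = r * t k"
      have y: "\<bar>y\<bar> = t k" using r t(1)[of k] by (simp add: y_def abs_mult)
      have fb: "norm (f s) \<le> E k" if s: "Re s \<in> {1 - c..c}" "Im s = y" for s
      proof (cases "Re s \<ge> 1 / 2")
        case True
        have "s = Complex (Re s) y" using s by (simp add: complex_eq_iff)
        with elim(2)[rule_format, of "Re s" y] True s y show ?thesis by auto
      next
        \<comment> \<open>Here 1 - s lies in the right half at height -y, where the bound holds too,
          and \<open>norm \<epsilon> = 1\<close> transfers it to s.\<close>
        case False
        have "norm (f (Complex (1 - Re s) (- y))) \<le> E k"
          using elim(2)[rule_format, of "1 - Re s" "- y"] s y False by auto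
        moreover have "Complex (1 - Re s) (- y) = 1 - s" using s by (simp add: complex_eq_iff)
        ultimately show ?thesis using fe[of s] \<epsilon> by (simp add: norm_mult)
      qed
      have "E k \<ge> 0" using order_trans[OF norm_ge_zero fb[of "Complex c y"]] c by simp
      have "norm (H y) \<le> (E k * G) * norm (Complex c y - Complex (1 - c) y)"
        unfolding H_def
      proof (rule contour_integral_bound_linepath)
        show "?F contour_integrable_on linepath (Complex (1 - c) y) (Complex c y)"
          using continuous[OF t(1) elim(1) y] by (rule contour_integrable_continuous_linepath)
        fix s assume "s \<in> closed_segment (Complex (1 - c) y) (Complex c y)"
        then have s: "Re s \<in> {1 - c..c}" "Im s = y"
          using c by (auto simp: closed_segment_same_Im closed_segment_eq_real_ivl)
        show "norm (?F s) \<le> E k * G"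
          unfolding norm_mult using fb[OF s] G[OF s(1)] \<open>E k \<ge> 0\<close> by (intro mult_mono) auto
      qed (use \<open>E k \<ge> 0\<close> \<open>G \<ge> 0\<close> in auto)
      also have "Complex c y - Complex (1 - c) y = of_real (2 * c - 1)" by (simp add: complex_eq_iff)
      finally show ?case using c by (simp add: y_def del: of_real_diff of_real_mult)
    qed
  qed
  have "eventually (\<lambda>k. 1 / (2 * of_real pi) * V1 (t k) - \<epsilon> * (1 / (2 * of_real pi) * V2 (t k))
        + (H ((- 1) * t k) - H (1 * t k)) / (2 * of_real pi * \<i>)
      = (\<Sum>z | is_pole f z \<and> \<bar>Im z\<bar> < t k. residue ?F z)) sequentially"
    using height by eventually_elim (simp add: residues[OF t(1)])
  moreover have "(\<lambda>k. 1 / (2 * of_real pi) * V1 (t k) - \<epsilon> * (1 / (2 * of_real pi) * V2 (t k))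
        + (H ((- 1) * t k) - H (1 * t k)) / (2 * of_real pi * \<i>)) \<longlonglongrightarrow>
      1 / (2 * of_real pi) * (LINT y|lborel. f (Complex c y) * g (Complex c y))
      - \<epsilon> * (1 / (2 * of_real pi) * (LINT y|lborel. f (Complex c y) * g (1 - Complex c y)))
      + (0 - 0) / (2 * of_real pi * \<i>)"
    unfolding V1_def V2_def
    by (intro tendsto_intros integral_symmetric_interval_tendsto int1 int2 t H0) auto
  ultimately show ?thesis
    by (simp add: tendsto_cong)
qed

subsection \<open>Estimates for the class F\<close>

text \<open>Comparison with a multiple of 1/(1 + y^2): by the decay for |y| >= 1, by continuity on
  the compact rest. The factor 2 comes from 1/x <= 2/(1 + x) for x >= 1, and it also makes 2/(1 +
  y^2) at least 1 for |y| <= 1.\<close>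

lemma integrable_of_quadratic_decay:
  fixes h :: "real \<Rightarrow> complex"
  assumes cont: "continuous_on UNIV h"
    and B: "\<And>y. \<bar>y\<bar> \<ge> 1 \<Longrightarrow> norm (h y) \<le> B * \<bar>y\<bar> powr (- 2)"
  shows "integrable lborel h"
proof -
  have "bounded (h ` {- 1..1})"
    by (intro compact_imp_bounded compact_continuous_image continuous_on_subset[OF cont]) auto
  then obtain M where M: "\<And>y. \<bar>y\<bar> \<le> 1 \<Longrightarrow> norm (h y) \<le> M"
    unfolding bounded_iff by (metis abs_le_iff atLeastAtMost_iff image_eqI minus_le_iff)
  have inv: "inverse x \<le> 2 * inverse (1 + x)" if "x \<ge> 1" for x :: real
    using that by (simp add: field_simps)
  show ?thesis
  proof (rule Bochner_Integration.integrable_bound)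
    show "integrable lborel (\<lambda>y::real. 2 * (\<bar>M\<bar> + \<bar>B\<bar>) * inverse (1 + y\<^sup>2))"
      using integrable_inverse_1_plus_square by (simp add: set_integrable_def)
    show "h \<in> borel_measurable lborel"
      using cont by (simp add: borel_measurable_continuous_onI)
    have "norm (h y) \<le> 2 * (\<bar>M\<bar> + \<bar>B\<bar>) * inverse (1 + y\<^sup>2)" for y
    proof (cases "\<bar>y\<bar> \<ge> 1")
      case True
      then have y: "y\<^sup>2 \<ge> 1" by (metis abs_ge_zero one_le_power power2_abs)
      have "norm (h y) \<le> B * inverse (y\<^sup>2)"
        using B[OF True] True by (simp add: powr_minus)
      also have "\<dots> \<le> (\<bar>M\<bar> + \<bar>B\<bar>) * inverse (y\<^sup>2)"
        by (intro mult_right_mono) auto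
      also have "\<dots> \<le> (\<bar>M\<bar> + \<bar>B\<bar>) * (2 * inverse (1 + y\<^sup>2))"
        using inv[of "y\<^sup>2"] y by (intro mult_left_mono) auto
      finally show ?thesis by (simp only: mult.left_commute mult.assoc)
    next
      case False
      then have "y\<^sup>2 \<le> 1" by (simp add: abs_square_le_1)
      then have "1 \<le> 2 * inverse (1 + y\<^sup>2)"
        by (simp add: field_simps add_pos_nonneg)
      have "norm (h y) \<le> (\<bar>M\<bar> + \<bar>B\<bar>) * 1" using M[of y] False by auto
      also have "\<dots> \<le> (\<bar>M\<bar> + \<bar>B\<bar>) * (2 * inverse (1 + y\<^sup>2))"
        by (intro mult_left_mono) (use \<open>1 \<le> 2 * inverse (1 + y\<^sup>2)\<close> in auto)
      finally show ?thesis by (simp only: mult.left_commute mult.assoc)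
    qed
    then show "AE y in lborel. norm (h y) \<le> norm (2 * (\<bar>M\<bar> + \<bar>B\<bar>) * inverse (1 + y\<^sup>2))"
      by (intro AE_I2) (metis abs_ge_self order_trans real_norm_def)
  qed
qed

text \<open>The singularities form a sparse, hence countable set, and so do their real parts form a
  countable one. As intervals are uncountable, vertical lines free of singularities can be found in
  any of them.\<close>

lemma countable_nonanalytic_abscissae:
  assumes "f meromorphic_on UNIV"
  shows "countable {c. \<exists>y. \<not> f analytic_on {Complex c y}}"
proof -
  have "countable (Re ` (UNIV \<inter> {z. \<not> f analytic_on {z}}))"
    by (intro countable_image sparse_imp_countable meromorphic_on_imp_sparse_singularities assms) simp
  moreover have "{c. \<exists>y. \<not> f analytic_on {Complex c y}} \<subseteq> Re ` (UNIV \<inter> {z. \<not> f analytic_on {z}})"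
    by (force intro: image_eqI)
  ultimately show ?thesis by (rule countable_subset[rotated])
qed

text \<open>At the heights \<open>t k\<close>, D grows at most polynomially: inside the widened
  strip by the condition on the horizontal segments, to the right of it by the half-plane bound. The
  rapid decay of \<gamma> wins with one power to spare.\<close>

lemma class_F_with_bound_at_heights:
  assumes F: "class_F_with \<gamma> D w t"
  obtains \<delta> K where "\<delta> > 0"
    "eventually (\<lambda>k. \<forall>\<sigma>\<in>{1 / 2 - w - \<delta>..c}. \<forall>y. \<bar>y\<bar> = t k \<longrightarrow>
       norm (\<gamma> (Complex \<sigma> y) * D (Complex \<sigma> y)) \<le> K / t k) sequentially"
proof -
  from F obtain A2 B2 \<delta> where \<delta>: "\<delta> > 0" and
    mid: "\<And>k \<sigma>. \<sigma> \<in> {1 / 2 - w - \<delta>..1 / 2 + w + \<delta>} \<Longrightarrow>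
        norm (D (Complex \<sigma> (t k))) \<le> B2 * t k powr A2 \<and> norm (D (Complex \<sigma> (- t k))) \<le> B2 * t k powr A2"
    unfolding class_F_with_def by meson
  from F obtain A1 where
    A1: "\<And>a b. 1 / 2 + w < a \<Longrightarrow> a \<le> b \<Longrightarrow>
        \<exists>B. \<exists>t0>0. \<forall>\<sigma>\<in>{a..b}. \<forall>y. \<bar>y\<bar> \<ge> t0 \<longrightarrow> norm (D (Complex \<sigma> y)) \<le> B * \<bar>y\<bar> powr A1"
    unfolding class_F_with_def by meson
  obtain B1 t1 where "t1 > 0" and
    right: "\<And>\<sigma> y. \<sigma> \<in> {1 / 2 + w + \<delta>..c} \<Longrightarrow> \<bar>y\<bar> \<ge> t1 \<Longrightarrow> norm (D (Complex \<sigma> y)) \<le> B1 * \<bar>y\<bar> powr A1"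
  proof (cases "1 / 2 + w + \<delta> \<le> c")
    case True
    with A1[of "1 / 2 + w + \<delta>" c] \<delta> that show thesis by (metis less_add_same_cancel1)
  \<comment> \<open>Otherwise the range of \<sigma> is empty and any constants serve.\<close>
  qed (use that[of 1 0] in auto)
  \<comment> \<open>Both exponents are at most A - 1, so the product of the two bounds is of order
    t^(-A) t^(A - 1) = 1/t.\<close>
  define A where "A = \<bar>A1\<bar> + \<bar>A2\<bar> + 1"
  \<comment> \<open>The decay condition asks for ordered end points; the maximum ensures this also
    when c is small.\<close>
  obtain B0 where
    gam: "\<And>\<sigma> y. \<sigma> \<in> {1 / 2 - w - \<delta>..max c (1 / 2 - w - \<delta>)} \<Longrightarrow> \<bar>y\<bar> \<ge> 1 \<Longrightarrow>
      norm (\<gamma> (Complex \<sigma> y)) \<le> B0 * \<bar>y\<bar> powr (- A)"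
  proof -
    have "A > 0" by (simp add: A_def add_nonneg_pos)
    then have "\<exists>B. \<forall>\<sigma>\<in>{1 / 2 - w - \<delta>..max c (1 / 2 - w - \<delta>)}. \<forall>y. \<bar>y\<bar> \<ge> 1 \<longrightarrow>
        norm (\<gamma> (Complex \<sigma> y)) \<le> B * \<bar>y\<bar> powr (- A)"
      using F unfolding class_F_with_def by (meson max.cobounded2 zero_less_one)
    with that show thesis by blast
  qed
  have "filterlim t at_top sequentially" using F by (simp add: class_F_with_def)
  \<comment> \<open>From height 1 on, the decay bound for \<gamma> applies and powers increase with
    the exponent; \<open>t1\<close> is where the bound on D to the right of the strip sets
    in.\<close>
  then have "eventually (\<lambda>k. t k \<ge> max 1 t1) sequentially" unfolding filterlim_at_top by blast
  then have "eventually (\<lambda>k. \<forall>\<sigma>\<in>{1 / 2 - w - \<delta>..c}. \<forall>y. \<bar>y\<bar> = t k \<longrightarrow>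
       norm (\<gamma> (Complex \<sigma> y) * D (Complex \<sigma> y)) \<le> \<bar>B0\<bar> * (\<bar>B1\<bar> + \<bar>B2\<bar>) / t k) sequentially"
  proof eventually_elim
    case (elim k)
    then have tk: "t k \<ge> 1" "t k \<ge> t1" by auto
    show ?case
    proof (intro ballI allI impI)
      fix \<sigma> y assume \<sigma>: "\<sigma> \<in> {1 / 2 - w - \<delta>..c}" and y: "\<bar>y\<bar> = t k"
      have mono: "B * t k powr p \<le> (\<bar>B1\<bar> + \<bar>B2\<bar>) * t k powr (A - 1)"
        if "B \<le> \<bar>B1\<bar> + \<bar>B2\<bar>" "p \<le> A - 1" for B p
        using that tk by (intro mult_mono powr_mono) auto
      have D: "norm (D (Complex \<sigma> y)) \<le> (\<bar>B1\<bar> + \<bar>B2\<bar>) * t k powr (A - 1)"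
      proof (cases "\<sigma> \<le> 1 / 2 + w + \<delta>")
        case True
        moreover have "y = t k \<or> y = - t k" using y by linarith
        ultimately have "norm (D (Complex \<sigma> y)) \<le> B2 * t k powr A2"
          using \<sigma> mid[of \<sigma> k] by auto
        also have "\<dots> \<le> (\<bar>B1\<bar> + \<bar>B2\<bar>) * t k powr (A - 1)"
          by (rule mono) (auto simp: A_def)
        finally show ?thesis .
      next
        case False
        with \<sigma> right[of \<sigma> y] y tk have "norm (D (Complex \<sigma> y)) \<le> B1 * t k powr A1" by auto
        also have "\<dots> \<le> (\<bar>B1\<bar> + \<bar>B2\<bar>) * t k powr (A - 1)"
          by (rule mono) (auto simp: A_def)
        finally show ?thesis .
      qed
      have "norm (\<gamma> (Complex \<sigma> y)) \<le> B0 * t k powr (- A)"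
        using gam[of \<sigma> y] \<sigma> y tk by auto
      also have "\<dots> \<le> \<bar>B0\<bar> * t k powr (- A)" by (intro mult_right_mono) auto
      finally have "norm (\<gamma> (Complex \<sigma> y) * D (Complex \<sigma> y))
          \<le> (\<bar>B0\<bar> * t k powr (- A)) * ((\<bar>B1\<bar> + \<bar>B2\<bar>) * t k powr (A - 1))"
        unfolding norm_mult using D by (intro mult_mono) auto
      also have "\<dots> = \<bar>B0\<bar> * (\<bar>B1\<bar> + \<bar>B2\<bar>) * (t k powr (- A) * t k powr (A - 1))"
        by (simp add: mult_ac)
      also have "t k powr (- A) * t k powr (A - 1) = t k powr (- 1)"
        by (simp only: powr_add[symmetric]) simp
      also have "\<dots> = 1 / t k"
        using tk by (simp add: powr_minus_divide)
      finally show "norm (\<gamma> (Complex \<sigma> y) * D (Complex \<sigma> y)) \<le> \<bar>B0\<bar> * (\<bar>B1\<bar> + \<bar>B2\<bar>) / t k"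
        by simp
    qed
  qed
  with \<delta> show thesis by (rule that)
qed

text \<open>Supplies what termwise integration requires: analyticity of \<gamma> on the line gives
  continuity at small heights, where the decay says nothing, and the decay gives integrability at
  large ones.\<close>

lemma class_F_with_line_sums:
  fixes d :: "nat \<Rightarrow> complex"
  assumes F: "class_F_with \<gamma> D w t"
    and c: "\<And>y. \<gamma> analytic_on {Complex c y}"
    and dirichlet: "\<And>s. Re s > \<sigma>0 \<Longrightarrow> (\<lambda>n. d (Suc n) * of_nat (Suc n) powr (- s)) sums D s"
    and "c > \<sigma>0 + 2"
    and \<kappa>: "\<And>u. u > 0 \<Longrightarrow> \<kappa> u = inverse_mellin \<gamma> c u"
    and f: "supported_on a b f"
  shows "integrable lborel (\<lambda>y. \<gamma> (Complex c y) * D (Complex c y) * mellin f (Complex c y))"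
    and "(\<lambda>n. d (Suc n) * mult_conv f \<kappa> (real (Suc n))) sums
     (1 / (2 * of_real pi) *
       (LINT y|lborel. \<gamma> (Complex c y) * D (Complex c y) * mellin f (Complex c y)))"
proof -
  have "continuous_on UNIV (\<lambda>y. \<gamma> (Complex c y))"
  proof (rule continuous_at_imp_continuous_on, rule ballI)
    fix y
    have "isCont (Complex c) y"
      unfolding Complex_eq by (intro continuous_intros)
    then show "isCont (\<lambda>y. \<gamma> (Complex c y)) y"
      by (rule isCont_o2) (rule analytic_at_imp_isCont[OF c])
  qed
  \<comment> \<open>The decay condition with A = 2 on the one-point interval [c, c].\<close>
  moreover obtain B where "\<And>y. \<bar>y\<bar> \<ge> 1 \<Longrightarrow> norm (\<gamma> (Complex c y)) \<le> B * \<bar>y\<bar> powr (- 2)"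
    using F unfolding class_F_with_def by (metis atLeastAtMost_iff order_refl zero_less_numeral zero_less_one)
  ultimately have \<gamma>: "integrable lborel (\<lambda>y. \<gamma> (Complex c y))"
    by (rule integrable_of_quadratic_decay)
  \<comment> \<open>The series converges at \<sigma>0 + 1, hence absolutely more than 1 further to
    the right; this accounts for the margin 2 in \<open>c > \<sigma>0 + 2\<close>.\<close>
  have "summable (\<lambda>n. norm (d (Suc n)) * real (Suc n) powr (- c))"
  proof (rule dirichlet_series_abs_summable)
    show "summable (\<lambda>n. d (Suc n) * of_nat (Suc n) powr (- of_real (\<sigma>0 + 1)))"
      by (rule sums_summable[OF dirichlet]) simp
  qed (use \<open>c > \<sigma>0 + 2\<close> in simp)
  moreover have "(\<lambda>n. d (Suc n) * of_nat (Suc n) powr (- Complex c y)) sums D (Complex c y)" for y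
    using \<open>c > \<sigma>0 + 2\<close> by (intro dirichlet) simp
  ultimately show "integrable lborel (\<lambda>y. \<gamma> (Complex c y) * D (Complex c y) * mellin f (Complex c y))"
    and "(\<lambda>n. d (Suc n) * mult_conv f \<kappa> (real (Suc n))) sums
     (1 / (2 * of_real pi) *
       (LINT y|lborel. \<gamma> (Complex c y) * D (Complex c y) * mellin f (Complex c y)))"
    using dirichlet_mult_conv_sums[OF f \<gamma> \<kappa>] by blast+
qed

subsection \<open>The explicit formula\<close>

theorem corollary4p6:
  fixes \<gamma> D Z :: "complex \<Rightarrow> complex"
    and \<epsilon> :: complex
    and \<phi> :: "real \<Rightarrow> real"
    and d :: "nat \<Rightarrow> complex"
    and \<sigma>0 :: real
    and C :: "complex \<Rightarrow> nat \<Rightarrow> complex"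
    and \<kappa> :: "real \<Rightarrow> complex"
  defines "\<Phi> \<equiv> (\<lambda>x. complex_of_real (\<phi> x))"
  assumes Z: "Z = (\<lambda>s. \<gamma> s * D s)"
    and F: "class_F \<gamma> D"
    and eps: "\<epsilon> = 1 \<or> \<epsilon> = - 1"
    and phi: "smooth_compact_support_pos \<phi>"
    and functional_equation: "\<forall>\<^sub>\<approx>s\<in>UNIV. Z s = \<epsilon> * Z (1 - s)"
    and dirichlet: "\<And>s. Re s > \<sigma>0 \<Longrightarrow> (\<lambda>n. d (Suc n) * of_nat (Suc n) powr (- s)) sums D s"
    and kappa: "\<And>c x. c > \<sigma>0 \<Longrightarrow> x > 0 \<Longrightarrow> \<kappa> x = inverse_mellin \<gamma> c x"
    and principal_part: "principal_part_coeffs Z C"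
  defines "R \<equiv> (\<lambda>m. d m * (mult_conv \<Phi> \<kappa> (real m) - \<epsilon> * mult_conv (vee \<Phi>) \<kappa> (real m)))"
  shows "summable (\<lambda>n. R (Suc n)) \<and>
    (\<forall>w t. class_F_with \<gamma> D w t \<longrightarrow>
       pole_sum_converges_to Z t
         (\<lambda>z. \<Sum>m=1..pole_mult Z z. C z m / fact (m - 1) * (deriv ^^ (m - 1)) (mellin \<Phi>) z)
         (\<Sum>n. R (Suc n)))"
proof -
  obtain a b where f: "supported_on a b \<Phi>"
    using smooth_compact_support_pos_supported_on[OF phi] unfolding \<Phi>_def by blast
  have \<gamma>D: "\<gamma> meromorphic_on UNIV" "D meromorphic_on UNIV"
    using F by (auto simp: class_F_def class_F_with_def)
  then have Z_mero: "Z meromorphic_on UNIV"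
    unfolding Z by (intro meromorphic_intros)
  have Z_at: "Z meromorphic_on {z}" for z
    using Z_mero by (rule meromorphic_on_subset) simp
  have \<epsilon>: "\<epsilon> \<noteq> 0" "norm \<epsilon> = 1" using eps by auto
  \<comment> \<open>Values of \<open>\<gamma>\<close> and \<open>Z\<close> at removable singularities are arbitrary, and \<open>\<gamma>\<close> may have real poles
    where \<open>D\<close> vanishes; a line avoiding all of these exists arbitrarily far to the right.\<close>
  have line: "\<exists>c>c0. \<forall>y. \<gamma> analytic_on {Complex c y} \<and> Z analytic_on {Complex c y}" for c0
  proof -
    let ?N = "{c. \<exists>y. \<not> \<gamma> analytic_on {Complex c y}} \<union> {c. \<exists>y. \<not> Z analytic_on {Complex c y}}"
    have "countable ?N"
      using countable_nonanalytic_abscissae[OF \<gamma>D(1)] countable_nonanalytic_abscissae[OF Z_mero] by (rule countable_Un)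
    moreover have "uncountable {c0<..<c0 + 1}" by (simp add: uncountable_open_interval)
    ultimately have "\<not> {c0<..<c0 + 1} \<subseteq> ?N" using countable_subset by blast
    then obtain c where "c \<in> {c0<..<c0 + 1}" "c \<notin> ?N" by blast
    then show ?thesis by auto
  qed
  define M where "M = mellin \<Phi>"
  \<comment> \<open>Both parts of the series become integrals over one and the same line. The series
    itself does not involve c, so the line can be chosen later to suit the strip.\<close>
  have integrals:
    "integrable lborel (\<lambda>y. Z (Complex c y) * M (Complex c y))"
    "integrable lborel (\<lambda>y. Z (Complex c y) * M (1 - Complex c y))"
    "(\<lambda>n. R (Suc n)) sums
      (1 / (2 * of_real pi) * (LINT y|lborel. Z (Complex c y) * M (Complex c y))
       - \<epsilon> * (1 / (2 * of_real pi) * (LINT y|lborel. Z (Complex c y) * M (1 - Complex c y))))"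
    if c: "c > \<sigma>0 + 2" "\<And>y. \<gamma> analytic_on {Complex c y}" for c
  proof -
    obtain w t where F': "class_F_with \<gamma> D w t" using F by (auto simp: class_F_def)
    have \<kappa>: "\<kappa> u = inverse_mellin \<gamma> c u" if "u > 0" for u using kappa that c by simp
    \<comment> \<open>Stated for a general g, to be used for \<Phi> and for
      \<open>vee \<Phi>\<close>; the latter turns M(s) into M(1 - s).\<close>
    have L: "integrable lborel (\<lambda>y. \<gamma> (Complex c y) * D (Complex c y) * mellin g (Complex c y))"
      "(\<lambda>n. d (Suc n) * mult_conv g \<kappa> (real (Suc n))) sums
        (1 / (2 * of_real pi) *
          (LINT y|lborel. \<gamma> (Complex c y) * D (Complex c y) * mellin g (Complex c y)))"
      if "supported_on a' b' g" for a' b' g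
      by (rule class_F_with_line_sums[OF F' c(2) dirichlet c(1) \<kappa> that]; assumption)+
    show "integrable lborel (\<lambda>y. Z (Complex c y) * M (Complex c y))"
      "integrable lborel (\<lambda>y. Z (Complex c y) * M (1 - Complex c y))"
      using L(1)[OF f] L(1)[OF supported_on_vee[OF f]] by (simp_all add: Z M_def mellin_vee[OF f])
    have "(\<lambda>n. d (Suc n) * mult_conv \<Phi> \<kappa> (real (Suc n))
        - \<epsilon> * (d (Suc n) * mult_conv (vee \<Phi>) \<kappa> (real (Suc n)))) sums
      (1 / (2 * of_real pi) * (LINT y|lborel. Z (Complex c y) * M (Complex c y))
       - \<epsilon> * (1 / (2 * of_real pi) * (LINT y|lborel. Z (Complex c y) * M (1 - Complex c y))))"
      using L(2)[OF f] L(2)[OF supported_on_vee[OF f]]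
      unfolding Z M_def mellin_vee[OF f] by (intro sums_diff sums_mult)
    then show "(\<lambda>n. R (Suc n)) sums
      (1 / (2 * of_real pi) * (LINT y|lborel. Z (Complex c y) * M (Complex c y))
       - \<epsilon> * (1 / (2 * of_real pi) * (LINT y|lborel. Z (Complex c y) * M (1 - Complex c y))))"
      by (simp add: R_def algebra_simps)
  qed
  have M: "M holomorphic_on UNIV" unfolding M_def by (rule mellin_holomorphic[OF f])
  \<comment> \<open>Filling in the removable singularities changes neither poles nor residues, but
    makes the function analytic off its poles and the functional equation valid at every
    point.\<close>
  define Z' where "Z' = remove_sings Z"
  have iso: "isolated_singularity_at Z z" for z
    by (rule meromorphic_on_isolated_singularity[OF Z_at])
  have pole: "is_pole Z' z \<longleftrightarrow> is_pole Z z" for z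
    unfolding Z'_def using iso by simp
  have Z': "Z' nicely_meromorphic_on UNIV"
    unfolding Z'_def using Z_mero by (rule remove_sings_nicely_meromorphic)
  have residue: "residue (\<lambda>s. Z' s * M s) z =
      (\<Sum>m=1..pole_mult Z z. C z m / fact (m - 1) * (deriv ^^ (m - 1)) M z)" if "is_pole Z z" for z
  proof -
    have "residue (\<lambda>s. Z' s * M s) z = residue (\<lambda>s. Z s * M s) z"
      using eventually_remove_sings_eq_at[OF iso[of z]]
      by (intro residue_cong) (auto simp: Z'_def elim!: eventually_mono)
    then show ?thesis
      using principal_part that residue_principal_part_mult[OF iso _ M]
      unfolding principal_part_coeffs_def by simp
  qed
  have "pole_sum_converges_to Z t
      (\<lambda>z. \<Sum>m=1..pole_mult Z z. C z m / fact (m - 1) * (deriv ^^ (m - 1)) M z) (\<Sum>n. R (Suc n))"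
    if F': "class_F_with \<gamma> D w t" for w t
  proof -
    have w: "w > 0" and t: "\<And>k. t k > 0" "filterlim t at_top sequentially"
      and strip: "\<And>z. is_pole Z z \<Longrightarrow> \<bar>Re z - 1 / 2\<bar> \<le> w"
      using F' by (auto simp: class_F_with_def Z)
    \<comment> \<open>Beyond \<sigma>0 + 2 the Dirichlet series can be integrated termwise, and
      beyond 1/2 + w there are no poles.\<close>
    obtain c where c: "c > max (\<sigma>0 + 2) (1 / 2 + w)"
      and an: "\<And>y. \<gamma> analytic_on {Complex c y}" "\<And>y. Z analytic_on {Complex c y}"
      using line by metis
    have Z'_line: "Z' (Complex c y) = Z (Complex c y)" for y
      unfolding Z'_def using an by simp
    obtain \<delta> K where \<delta>: "\<delta> > 0" and K: "eventually (\<lambda>k. \<forall>\<sigma>\<in>{1 / 2 - w - \<delta>..c}. \<forall>y. \<bar>y\<bar> = t k \<longrightarrow>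
       norm (\<gamma> (Complex \<sigma> y) * D (Complex \<sigma> y)) \<le> K / t k) sequentially"
      using class_F_with_bound_at_heights[OF F'] by blast
    \<comment> \<open>The estimate at height T concerns the given values of \<gamma> and D, which
      are arbitrary at singularities. The segment is connected with distinct end points, so each of
      its points is a limit of others, and the estimate along it excludes poles and controls
      Z'.\<close>
    have bound: "\<not> is_pole Z (Complex \<sigma> y) \<and> norm (Z' (Complex \<sigma> y)) \<le> K / T"
      if bd: "\<forall>\<sigma>\<in>{1 / 2 - w - \<delta>..c}. \<forall>y. \<bar>y\<bar> = T \<longrightarrow> norm (\<gamma> (Complex \<sigma> y) * D (Complex \<sigma> y)) \<le> K / T"
        and \<sigma>: "\<sigma> \<in> {1 / 2 - w - \<delta>..c}" and y: "\<bar>y\<bar> = T" for T \<sigma> y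
    proof -
      let ?S = "closed_segment (Complex (1 / 2 - w - \<delta>) y) (Complex c y)"
      have S: "s \<in> ?S \<longleftrightarrow> Re s \<in> {1 / 2 - w - \<delta>..c} \<and> Im s = y" for s
        using c w \<delta> by (auto simp: closed_segment_same_Im closed_segment_eq_real_ivl)
      have "Complex \<sigma> y islimpt ?S"
      proof (rule connected_imp_perfect)
        have "Complex (1 / 2 - w - \<delta>) y \<in> ?S" "Complex c y \<in> ?S" by simp_all
        moreover have "Complex (1 / 2 - w - \<delta>) y \<noteq> Complex c y" using c w \<delta> by simp
        ultimately show "?S \<noteq> {s}" for s by (metis singletonD)
      qed (use S \<sigma> in auto)
      moreover have "norm (Z s) \<le> K / T" if "s \<in> ?S" for s
      proof -
        have "Re s \<in> {1 / 2 - w - \<delta>..c}" "s = Complex (Re s) y"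
          using that S[of s] by (simp_all add: complex_eq_iff)
        with bd y show ?thesis unfolding Z by metis
      qed
      ultimately show ?thesis
        unfolding Z'_def by (intro conjI meromorphic_bounded_on_limpt[OF Z_at])
    qed
    obtain G where G: "\<And>s. Re s \<in> {1 - c..c} \<Longrightarrow> norm (M s) \<le> G"
      unfolding M_def using mellin_bounded_on_strip[OF f] by blast
    have "(\<lambda>k. \<Sum>z | is_pole Z' z \<and> \<bar>Im z\<bar> < t k. residue (\<lambda>s. Z' s * M s) z) \<longlonglongrightarrow>
      1 / (2 * of_real pi) * (LINT y|lborel. Z' (Complex c y) * M (Complex c y))
      - \<epsilon> * (1 / (2 * of_real pi) * (LINT y|lborel. Z' (Complex c y) * M (1 - Complex c y)))"
    proof (rule residue_sum_tendsto[OF Z' M _ \<epsilon>(2)])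
      show "Z' s = \<epsilon> * Z' (1 - s)" for s
        unfolding Z'_def by (rule remove_sings_reflection[OF Z_mero functional_equation \<epsilon>(1)])
      show "\<bar>Re z - 1 / 2\<bar> < c - 1 / 2" if "is_pole Z' z" for z
        using strip[of z] that c by (simp add: pole)
      \<comment> \<open>A pole at height \<open>t k\<close> would lie in the strip, hence on the
        segment where the bound excludes poles for large k.\<close>
      show "eventually (\<lambda>k. \<forall>z. is_pole Z' z \<longrightarrow> \<bar>Im z\<bar> \<noteq> t k) sequentially"
        using K
      proof eventually_elim
        case (elim k)
        show ?case
        proof (intro allI impI notI)
          fix z assume z: "is_pole Z' z" "\<bar>Im z\<bar> = t k"
          with strip[of z] c \<delta> have "Re z \<in> {1 / 2 - w - \<delta>..c}" by (auto simp: pole abs_le_iff)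
          with bound[OF elim this z(2)] z(1) show False by (simp add: pole)
        qed
      qed
      show "eventually (\<lambda>k. \<forall>\<sigma>\<in>{1 / 2..c}. \<forall>y. \<bar>y\<bar> = t k \<longrightarrow> norm (Z' (Complex \<sigma> y)) \<le> K / t k) sequentially"
        using K by eventually_elim (use bound w \<delta> in auto)
      show "(\<lambda>k. K / t k) \<longlonglongrightarrow> 0"
        using t(2) by (intro tendsto_divide_0[OF tendsto_const] filterlim_at_top_imp_at_infinity)
      show "integrable lborel (\<lambda>y. Z' (Complex c y) * M (Complex c y))"
        "integrable lborel (\<lambda>y. Z' (Complex c y) * M (1 - Complex c y))"
        unfolding Z'_line using c an(1) by (intro integrals; simp)+
      show "c > 1 / 2" using c w by simp
    qed (fact t G)+
    \<comment> \<open>On the chosen line Z' and Z agree, so the limit is the sum of the series; c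
      has disappeared, and the value is the same for every sequence of heights.\<close>
    also have "1 / (2 * of_real pi) * (LINT y|lborel. Z' (Complex c y) * M (Complex c y))
      - \<epsilon> * (1 / (2 * of_real pi) * (LINT y|lborel. Z' (Complex c y) * M (1 - Complex c y)))
      = (\<Sum>n. R (Suc n))"
      unfolding Z'_line using c an by (intro sums_unique integrals(3)) auto
    also have "(\<lambda>k. \<Sum>z | is_pole Z' z \<and> \<bar>Im z\<bar> < t k. residue (\<lambda>s. Z' s * M s) z) =
      (\<lambda>k. \<Sum>z | is_pole Z z \<and> \<bar>Im z\<bar> < t k.
        \<Sum>m=1..pole_mult Z z. C z m / fact (m - 1) * (deriv ^^ (m - 1)) M z)"
      by (intro ext sum.cong) (auto simp: pole residue)
    finally show ?thesis
      unfolding pole_sum_converges_to_def using finite_poles_rectangle[OF Z_mero strip] by blast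
  qed
  moreover have "summable (\<lambda>n. R (Suc n))"
  proof -
    obtain c where "c > \<sigma>0 + 2" "\<And>y. \<gamma> analytic_on {Complex c y}"
      using line by metis
    then show ?thesis by (rule sums_summable[OF integrals(3)])
  qed
  ultimately show ?thesis unfolding M_def by blast
qed

end
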